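(* Let $A$ be a ring and let $X$ be a finitely generated $\Sigma$-d-Rickart $A$-module with endomorphism ring $S=\operatorname{End}_A(X)$. Then $S$ is a left hereditary ring.
   Context: Rings are associative with unity and modules are unital right $A$-modules; endomorphisms of $X$ act on the left, so that $X$ is a left $S$-module. A module $M$ is d-Rickart if $\operatorname{Im}(\phi)$ is a direct summand of $M$ for every $\phi\in\operatorname{End}_A(M)$. A module $X$ is $\Sigma$-d-Rickart if the direct sum $X^{(\Lambda)}$ of $\Lambda$ copies of $X$ is d-Rickart for every non-empty index set $\Lambda$. A ring is left hereditary if each of its left ideals is projective. *)

theory Defs
  imports "HOL-Algebra.Module" "HOL-Algebra.AbelCoset"
begin

section \<open>Modules over a ring that need not be commutative\<close>

text \<open>
  Modules are values of the record type \<open>('a, 'm) module\<close> of \<open>HOL-Algebra.Module\<close>, whose fields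
  \<open>mult\<close> and \<open>one\<close> are never used here; the library locale \<open>module\<close> itself requires a
  commutative ring of scalars. In a right module, \<open>a \<odot>\<^bsub>M\<^esub> x\<close> stands for the product \<open>x a\<close> with the
  scalar on the right, so the two locales differ only in the last axiom but one. Neither locale
  requires \<open>\<one> \<noteq> \<zero>\<close> in the ring.
\<close>

locale left_module = R?: ring R + M?: abelian_group M
  for R :: "('r, 'c) ring_scheme" (structure) and M :: "('r, 'm) module" (structure) +
  assumes smult_closed:
      "\<lbrakk> a \<in> carrier R; x \<in> carrier M \<rbrakk> \<Longrightarrow> a \<odot>\<^bsub>M\<^esub> x \<in> carrier M"
    and smult_l_distr:
      "\<lbrakk> a \<in> carrier R; b \<in> carrier R; x \<in> carrier M \<rbrakk> \<Longrightarrow>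
        (a \<oplus>\<^bsub>R\<^esub> b) \<odot>\<^bsub>M\<^esub> x = a \<odot>\<^bsub>M\<^esub> x \<oplus>\<^bsub>M\<^esub> b \<odot>\<^bsub>M\<^esub> x"
    and smult_r_distr:
      "\<lbrakk> a \<in> carrier R; x \<in> carrier M; y \<in> carrier M \<rbrakk> \<Longrightarrow>
        a \<odot>\<^bsub>M\<^esub> (x \<oplus>\<^bsub>M\<^esub> y) = a \<odot>\<^bsub>M\<^esub> x \<oplus>\<^bsub>M\<^esub> a \<odot>\<^bsub>M\<^esub> y"
    and smult_assoc:
      "\<lbrakk> a \<in> carrier R; b \<in> carrier R; x \<in> carrier M \<rbrakk> \<Longrightarrow>
        (a \<otimes>\<^bsub>R\<^esub> b) \<odot>\<^bsub>M\<^esub> x = a \<odot>\<^bsub>M\<^esub> (b \<odot>\<^bsub>M\<^esub> x)"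
    and smult_one: "x \<in> carrier M \<Longrightarrow> \<one>\<^bsub>R\<^esub> \<odot>\<^bsub>M\<^esub> x = x"

locale right_module = R?: ring R + M?: abelian_group M
  for R :: "('r, 'c) ring_scheme" (structure) and M :: "('r, 'm) module" (structure) +
  assumes smult_closed:
      "\<lbrakk> a \<in> carrier R; x \<in> carrier M \<rbrakk> \<Longrightarrow> a \<odot>\<^bsub>M\<^esub> x \<in> carrier M"
    and smult_l_distr:
      "\<lbrakk> a \<in> carrier R; b \<in> carrier R; x \<in> carrier M \<rbrakk> \<Longrightarrow>
        (a \<oplus>\<^bsub>R\<^esub> b) \<odot>\<^bsub>M\<^esub> x = a \<odot>\<^bsub>M\<^esub> x \<oplus>\<^bsub>M\<^esub> b \<odot>\<^bsub>M\<^esub> x"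
    and smult_r_distr:
      "\<lbrakk> a \<in> carrier R; x \<in> carrier M; y \<in> carrier M \<rbrakk> \<Longrightarrow>
        a \<odot>\<^bsub>M\<^esub> (x \<oplus>\<^bsub>M\<^esub> y) = a \<odot>\<^bsub>M\<^esub> x \<oplus>\<^bsub>M\<^esub> a \<odot>\<^bsub>M\<^esub> y"
    and smult_assoc:
      "\<lbrakk> a \<in> carrier R; b \<in> carrier R; x \<in> carrier M \<rbrakk> \<Longrightarrow>
        (a \<otimes>\<^bsub>R\<^esub> b) \<odot>\<^bsub>M\<^esub> x = b \<odot>\<^bsub>M\<^esub> (a \<odot>\<^bsub>M\<^esub> x)"
    and smult_one: "x \<in> carrier M \<Longrightarrow> \<one>\<^bsub>R\<^esub> \<odot>\<^bsub>M\<^esub> x = x"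

text \<open>
  The following notions read the same for left and right modules. Homomorphisms are extensional
  (\<open>undefined\<close> off the carrier), so that equality of homomorphisms is equality in HOL.
\<close>

definition mod_hom :: "('r, 'c) ring_scheme \<Rightarrow> ('r, 'm) module \<Rightarrow> ('r, 'n) module \<Rightarrow> ('m \<Rightarrow> 'n) set"
  where "mod_hom R M N =
    {f \<in> carrier M \<rightarrow>\<^sub>E carrier N.
      (\<forall>x\<in>carrier M. \<forall>y\<in>carrier M. f (x \<oplus>\<^bsub>M\<^esub> y) = f x \<oplus>\<^bsub>N\<^esub> f y) \<and>
      (\<forall>a\<in>carrier R. \<forall>x\<in>carrier M. f (a \<odot>\<^bsub>M\<^esub> x) = a \<odot>\<^bsub>N\<^esub> f x)}"

definition endo_ring :: "('r, 'c) ring_scheme \<Rightarrow> ('r, 'm) module \<Rightarrow> ('m \<Rightarrow> 'm) ring"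
  where "endo_ring R M =
    \<lparr>carrier = mod_hom R M M,
     monoid.mult = compose (carrier M),
     monoid.one = (\<lambda>x\<in>carrier M. x),
     ring.zero = (\<lambda>x\<in>carrier M. \<zero>\<^bsub>M\<^esub>),
     ring.add = (\<lambda>f g. \<lambda>x\<in>carrier M. f x \<oplus>\<^bsub>M\<^esub> g x)\<rparr>"

definition finitely_generated :: "('r, 'c) ring_scheme \<Rightarrow> ('r, 'm) module \<Rightarrow> bool"
  where "finitely_generated R M \<longleftrightarrow>
    (\<exists>B. finite B \<and> B \<subseteq> carrier M \<and> \<Inter>{N. submodule N R M \<and> B \<subseteq> N} = carrier M)"

definition direct_summand :: "('r, 'c) ring_scheme \<Rightarrow> ('r, 'm) module \<Rightarrow> 'm set \<Rightarrow> bool"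
  where "direct_summand R M N \<longleftrightarrow> submodule N R M \<and>
    (\<exists>K. submodule K R M \<and> N \<inter> K = {\<zero>\<^bsub>M\<^esub>} \<and> N <+>\<^bsub>M\<^esub> K = carrier M)"

definition direct_power :: "('r, 'm) module \<Rightarrow> 'i set \<Rightarrow> ('r, 'i \<Rightarrow> 'm) module"
  where "direct_power M \<Lambda> =
    \<lparr>carrier = {x \<in> \<Lambda> \<rightarrow>\<^sub>E carrier M. finite {i \<in> \<Lambda>. x i \<noteq> \<zero>\<^bsub>M\<^esub>}},
     monoid.mult = undefined,
     monoid.one = undefined,
     ring.zero = (\<lambda>i\<in>\<Lambda>. \<zero>\<^bsub>M\<^esub>),
     ring.add = (\<lambda>x y. \<lambda>i\<in>\<Lambda>. x i \<oplus>\<^bsub>M\<^esub> y i),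
     module.smult = (\<lambda>a x. \<lambda>i\<in>\<Lambda>. a \<odot>\<^bsub>M\<^esub> x i)\<rparr>"


section \<open>d-Rickart modules\<close>

definition d_rickart :: "('r, 'c) ring_scheme \<Rightarrow> ('r, 'm) module \<Rightarrow> bool"
  where "d_rickart R M \<longleftrightarrow> (\<forall>\<phi>\<in>mod_hom R M M. direct_summand R M (\<phi> ` carrier M))"

text \<open>
  A formula of HOL cannot quantify over types, so the index sets are the non-empty sets of
  elements of a type \<open>'i\<close>, which is a parameter of the notion. The property for all index sets
  whatsoever implies every instance, so a theorem that assumes it for an arbitrary infinite type
  \<open>'i\<close> covers that reading. The finite types must be excluded, since they
  would only give the finite direct sums.
\<close>

definition sigma_d_rickart :: "'i itself \<Rightarrow> ('r, 'c) ring_scheme \<Rightarrow> ('r, 'm) module \<Rightarrow> bool"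
  where "sigma_d_rickart _ R M \<longleftrightarrow> (\<forall>\<Lambda> :: 'i set. \<Lambda> \<noteq> {} \<longrightarrow> d_rickart R (direct_power M \<Lambda>))"


section \<open>Left hereditary rings\<close>

text \<open>
  Projectivity is the lifting property against all surjective homomorphisms \<open>g\<close> from a left
  module with elements of type \<open>'m\<close> onto one with elements of type \<open>'n\<close>. A theorem that
  concludes projectivity with \<open>'m\<close> and \<open>'n\<close> type variables occurring nowhere else asserts the
  lifting property against all surjections.
\<close>

definition projective ::
  "'m itself \<Rightarrow> 'n itself \<Rightarrow> ('r, 'c) ring_scheme \<Rightarrow> ('r, 'p) module \<Rightarrow> bool"
  where "projective _ _ R P \<longleftrightarrow> left_module R P \<and>
    (\<forall>(M :: ('r, 'm) module) (N :: ('r, 'n) module). left_module R M \<longrightarrow> left_module R N \<longrightarrow>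
      (\<forall>g\<in>mod_hom R M N. g ` carrier M = carrier N \<longrightarrow>
        (\<forall>f\<in>mod_hom R P N. \<exists>h\<in>mod_hom R P M. \<forall>x\<in>carrier P. g (h x) = f x)))"

definition left_ideal :: "'s set \<Rightarrow> ('s, 'c) ring_scheme \<Rightarrow> bool"
  where "left_ideal I S \<longleftrightarrow> additive_subgroup I S \<and> (\<forall>s\<in>carrier S. \<forall>x\<in>I. s \<otimes>\<^bsub>S\<^esub> x \<in> I)"

definition left_ideal_module :: "('s, 'c) ring_scheme \<Rightarrow> 's set \<Rightarrow> ('s, 's) module"
  where "left_ideal_module S I =
    \<lparr>carrier = I, monoid.mult = undefined, monoid.one = undefined,
     ring.zero = \<zero>\<^bsub>S\<^esub>, ring.add = (\<oplus>\<^bsub>S\<^esub>), module.smult = (\<otimes>\<^bsub>S\<^esub>)\<rparr>"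

definition left_hereditary :: "'m itself \<Rightarrow> 'n itself \<Rightarrow> ('s, 'c) ring_scheme \<Rightarrow> bool"
  where "left_hereditary m n S \<longleftrightarrow> ring S \<and>
    (\<forall>I. left_ideal I S \<longrightarrow> projective m n S (left_ideal_module S I))"


section \<open>The constructions have the expected structure\<close>

lemma (in right_module) smult_zero:
  assumes "a \<in> carrier R" shows "a \<odot>\<^bsub>M\<^esub> \<zero>\<^bsub>M\<^esub> = \<zero>\<^bsub>M\<^esub>"
  using smult_r_distr[of a "\<zero>\<^bsub>M\<^esub>" "\<zero>\<^bsub>M\<^esub>"] smult_closed[of a "\<zero>\<^bsub>M\<^esub>"] assms
  by (metis M.add.l_cancel_one' M.zero_closed M.add.l_one)

lemma (in right_module) smult_minus:
  assumes "a \<in> carrier R" "x \<in> carrier M"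
  shows "a \<odot>\<^bsub>M\<^esub> (\<ominus>\<^bsub>M\<^esub> x) = \<ominus>\<^bsub>M\<^esub> (a \<odot>\<^bsub>M\<^esub> x)"
  using assms smult_r_distr[of a "\<ominus>\<^bsub>M\<^esub> x" x] smult_closed smult_zero
  by (metis M.a_inv_closed M.l_neg M.minus_equality)

lemma (in right_module) ring_endo_ring: "ring (endo_ring R M)"
proof (rule ringI)
  show "abelian_group (endo_ring R M)"
  proof (rule abelian_groupI)
    fix f assume f: "f \<in> carrier (endo_ring R M)"
    have "(\<lambda>x\<in>carrier M. \<ominus>\<^bsub>M\<^esub> f x) \<in> carrier (endo_ring R M)"
      using f by (auto simp: endo_ring_def mod_hom_def PiE_iff M.minus_add smult_closed smult_minus)
    moreover have "(\<lambda>x\<in>carrier M. \<ominus>\<^bsub>M\<^esub> f x) \<oplus>\<^bsub>endo_ring R M\<^esub> f = \<zero>\<^bsub>endo_ring R M\<^esub>"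
      using f by (auto simp: endo_ring_def mod_hom_def PiE_iff M.l_neg)
    ultimately show "\<exists>g\<in>carrier (endo_ring R M). g \<oplus>\<^bsub>endo_ring R M\<^esub> f = \<zero>\<^bsub>endo_ring R M\<^esub>"
      by blast
  qed (auto simp: endo_ring_def mod_hom_def PiE_iff M.a_ac smult_closed smult_r_distr smult_zero
         extensional_def restrict_def)
  show "monoid (endo_ring R M)"
    by (rule monoidI)
      (auto simp: endo_ring_def mod_hom_def PiE_iff compose_def smult_closed
         extensional_def restrict_def)
qed (auto simp: endo_ring_def mod_hom_def PiE_iff compose_def restrict_def)

lemma (in right_module) right_module_direct_power:
  fixes \<Lambda> :: "'i set"
  shows "right_module R (direct_power M \<Lambda>)"
proof -
  have sup: "finite {i \<in> \<Lambda>. h (x i) (y i) \<noteq> \<zero>\<^bsub>M\<^esub>}"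
    if "finite {i \<in> \<Lambda>. x i \<noteq> \<zero>\<^bsub>M\<^esub>}" "finite {i \<in> \<Lambda>. y i \<noteq> \<zero>\<^bsub>M\<^esub>}" "h \<zero>\<^bsub>M\<^esub> \<zero>\<^bsub>M\<^esub> = \<zero>\<^bsub>M\<^esub>"
    for h and x y :: "'i \<Rightarrow> 'm"
    by (rule finite_subset[OF _ finite_UnI[OF that(1,2)]]) (use that(3) in auto)
  have "abelian_group (direct_power M \<Lambda>)"
  proof (rule abelian_groupI)
    fix x assume x: "x \<in> carrier (direct_power M \<Lambda>)"
    have "finite {i \<in> \<Lambda>. \<ominus>\<^bsub>M\<^esub> x i \<noteq> \<zero>\<^bsub>M\<^esub>}"
      using x sup[of x x "\<lambda>u v. \<ominus>\<^bsub>M\<^esub> u"] by (simp add: direct_power_def)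
    then have "(\<lambda>i\<in>\<Lambda>. \<ominus>\<^bsub>M\<^esub> x i) \<in> carrier (direct_power M \<Lambda>)"
      using x by (auto simp: direct_power_def PiE_iff cong: conj_cong)
    moreover have "(\<lambda>i\<in>\<Lambda>. \<ominus>\<^bsub>M\<^esub> x i) \<oplus>\<^bsub>direct_power M \<Lambda>\<^esub> x = \<zero>\<^bsub>direct_power M \<Lambda>\<^esub>"
      using x by (auto simp: direct_power_def PiE_iff M.l_neg)
    ultimately show "\<exists>y\<in>carrier (direct_power M \<Lambda>). y \<oplus>\<^bsub>direct_power M \<Lambda>\<^esub> x = \<zero>\<^bsub>direct_power M \<Lambda>\<^esub>"
      by blast
  next
    fix x y assume "x \<in> carrier (direct_power M \<Lambda>)" "y \<in> carrier (direct_power M \<Lambda>)"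
    then show "x \<oplus>\<^bsub>direct_power M \<Lambda>\<^esub> y \<in> carrier (direct_power M \<Lambda>)"
      using sup[of x y "add M"] by (auto simp: direct_power_def PiE_iff cong: conj_cong)
  qed (auto simp: direct_power_def PiE_iff M.a_ac extensional_def restrict_def)
  moreover have "a \<odot>\<^bsub>direct_power M \<Lambda>\<^esub> x \<in> carrier (direct_power M \<Lambda>)"
    if "a \<in> carrier R" "x \<in> carrier (direct_power M \<Lambda>)" for a x
    using that sup[of x x "\<lambda>u v. a \<odot>\<^bsub>M\<^esub> u"]
    by (auto simp: direct_power_def PiE_iff smult_closed smult_zero cong: conj_cong)
  ultimately show ?thesis
    by (intro right_module.intro R.ring_axioms right_module_axioms.intro)
      (auto simp: direct_power_def PiE_iff smult_closed smult_l_distr smult_r_distr smult_assoc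
         smult_one extensional_def restrict_def)
qed

lemma left_module_left_ideal_module:
  assumes "ring S" "left_ideal I S"
  shows "left_module S (left_ideal_module S I)"
proof -
  interpret S: ring S by fact
  interpret I: additive_subgroup I S using assms(2) by (simp add: left_ideal_def)
  have "abelian_group (left_ideal_module S I)"
    by (rule abelian_groupI)
      (auto simp: left_ideal_module_def I.a_closed I.zero_closed I.a_Hcarr S.a_ac
         intro!: bexI[where x = "\<ominus>\<^bsub>S\<^esub> _"] S.l_neg S.r_neg I.a_inv_closed)
  then show ?thesis
    using assms by (intro left_module.intro left_module_axioms.intro)
      (auto simp: left_ideal_module_def left_ideal_def I.a_Hcarr S.l_distr S.r_distr S.m_assoc)
qed

end

theory Submission
  imports Defs
begin

text \<open>
  Two consequences of the hypothesis are read off from endomorphisms of direct powers of \<open>X\<close>.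
  For finitely many elements \<open>b\<close> of \<open>S\<close>, the image of \<open>x \<mapsto> (b x)\<^sub>b\<close> in the finite power is a
  direct summand, and the matrix of a projection onto it splits the map from the free left
  module onto the left ideal generated by the \<open>b\<close>. For a sequence of endomorphisms, Bass's
  endomorphism of the countable power, together with finite generation, shows that a descending
  chain of principal left ideals of \<open>S\<close> becomes stationary. In particular, countable index sets
  suffice.

  Let \<open>J\<close> be the Jacobson radical. By the two properties every left annihilator is principal,
  so left annihilators satisfy the minimal condition too, and therefore \<open>J\<close> is nilpotent. Given a
  left ideal \<open>I\<close>, choose a maximal family in \<open>I\<close> that is independent modulo \<open>J I\<close>. It generates
  \<open>I\<close> modulo \<open>J I\<close>, hence generates \<open>I\<close>. By the splitting, the coefficients of a relation among
  members of the family can be moved into each power of \<open>J\<close>, so the relation is trivial. Thus \<open>I\<close>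
  is a direct sum of principal left ideals, and these are projective.
\<close>

section \<open>The Jacobson radical and left spans\<close>

text \<open>The splitting says that finitely generated left ideals of \<open>S\<close> are
  projective, so every left ideal is a directed union of projective ones and hence flat. The chain
  condition is Bass's characterisation of right perfect rings, over which flat right modules are
  projective; left ideals are on the wrong side for that theorem. Nilpotence of J, a left-right
  symmetric property, removes the obstacle: it makes Nakayama's argument work for left ideals that
  are not finitely generated, and it bounds how often a factor from J has to be extracted from the
  coefficients of a relation.

  A basis of I modulo J I would normally come from semisimplicity of S/J, which is never established
  here. Its substitute is an element b whose principal left ideal Sb is minimal among those not
  contained in a given left ideal W. Minimality forces the intersection of Sb and W into J b, and
  this is what an exchange argument needs in order to adjoin b to an independent family.\<close>

context ring
begin

lemma diff_zero_imp_eq: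
  assumes "x \<in> carrier R" "y \<in> carrier R" "x \<ominus> y = \<zero>"
  shows "x = y"
proof -
  have "x = (x \<ominus> y) \<oplus> y" using assms(1,2) by (simp add: minus_eq a_assoc l_neg)
  then show ?thesis using assms(2,3) by simp
qed

text \<open>The Jacobson radical in elementwise form, by left quasi-regularity instead of maximal
  left ideals. \<open>jac_fixed_zero\<close> consumes the left inverse, and
  \<open>minimal_generator_jac\<close> constructs one.\<close>

definition jac :: "'a set"
  where "jac = {x \<in> carrier R. \<forall>t\<in>carrier R. \<exists>u\<in>carrier R. u \<otimes> (\<one> \<ominus> t \<otimes> x) = \<one>}"

text \<open>As a left ideal, the n-th power of the radical is generated by these products.
  Annihilating an element, or carrying \<open>I\<close> into a left ideal, can be tested on them, so
  sums of products are not formed.\<close>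

primrec jac_prods :: "nat \<Rightarrow> 'a set"
  where
    "jac_prods 0 = {\<one>}"
  | "jac_prods (Suc n) = {a \<otimes> q |a q. a \<in> jac \<and> q \<in> jac_prods n}"

text \<open>With \<open>K = carrier R\<close> this is the left ideal generated by \<open>B\<close>;
  with \<open>K = jac\<close> and \<open>B\<close> a left ideal I it is the product J I.\<close>

inductive_set lspan :: "'a set \<Rightarrow> 'a set \<Rightarrow> 'a set" for K B
  where
    zero: "\<zero> \<in> lspan K B"
  | add: "\<lbrakk>u \<in> lspan K B; k \<in> K; b \<in> B\<rbrakk> \<Longrightarrow> u \<oplus> k \<otimes> b \<in> lspan K B"

lemma jac_carrier: "jac \<subseteq> carrier R"
  by (auto simp: jac_def)

lemma jac_mult:
  assumes "s \<in> carrier R" "x \<in> jac"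
  shows "s \<otimes> x \<in> jac"
  using assms by (auto simp: jac_def m_assoc[symmetric])

text \<open>Nakayama's lemma for a cyclic module: 1 - t x annihilates \<open>a\<close> and has a
  left inverse.\<close>

lemma jac_fixed_zero:
  assumes "x \<in> jac" "t \<in> carrier R" "a \<in> carrier R" "a = t \<otimes> (x \<otimes> a)"
  shows "a = \<zero>"
proof -
  have x: "x \<in> carrier R" using assms(1) by (simp add: jac_def)
  obtain u where u: "u \<in> carrier R" "u \<otimes> (\<one> \<ominus> t \<otimes> x) = \<one>"
    using assms(1,2) by (auto simp: jac_def)
  have "(\<one> \<ominus> t \<otimes> x) \<otimes> a = a \<ominus> t \<otimes> (x \<otimes> a)"
    using assms(2,3) x by (simp add: minus_eq l_distr l_minus m_assoc)
  also have "\<dots> = \<zero>"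
    using assms(3,4) by (metis minus_eq r_neg)
  finally have "(u \<otimes> (\<one> \<ominus> t \<otimes> x)) \<otimes> a = \<zero>"
    using u(1) assms(2,3) x by (simp add: m_assoc)
  then show ?thesis using u(2) assms(3) by simp
qed

lemma jac_prods_carrier: "jac_prods n \<subseteq> carrier R"
  using jac_carrier by (induction n) auto

lemma jac_prods_Suc_right:
  assumes "q \<in> jac_prods n" "a \<in> jac"
  shows "q \<otimes> a \<in> jac_prods (Suc n)"
  using assms
proof (induction n arbitrary: q)
  case 0
  then show ?case using jac_carrier by (auto intro!: exI[of _ a] simp: subset_iff)
next
  case (Suc n)
  then obtain c p where cp: "q = c \<otimes> p" "c \<in> jac" "p \<in> jac_prods n" by auto
  have "p \<otimes> a \<in> jac_prods (Suc n)" using Suc cp by blast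
  moreover have "q \<otimes> a = c \<otimes> (p \<otimes> a)"
    using cp jac_carrier jac_prods_carrier Suc.prems(2) by (auto simp: m_assoc subset_iff)
  ultimately show ?case using cp(2) by (subst jac_prods.simps) blast
qed

lemma jac_prods_Suc_rightE:
  assumes "q \<in> jac_prods (Suc n)"
  obtains p a where "q = p \<otimes> a" "p \<in> jac_prods n" "a \<in> jac"
proof -
  have "\<exists>p a. q = p \<otimes> a \<and> p \<in> jac_prods n \<and> a \<in> jac"
    using assms
  proof (induction n arbitrary: q)
    case 0
    then show ?case using jac_carrier
      by (auto simp: subset_iff intro!: exI[of _ "\<one>"] exI[of _ q])
  next
    case (Suc n)
    then obtain c p where cp: "q = c \<otimes> p" "c \<in> jac" "p \<in> jac_prods (Suc n)" by auto
    then obtain p' a where p': "p = p' \<otimes> a" "p' \<in> jac_prods n" "a \<in> jac"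
      using Suc.IH by blast
    have "q = (c \<otimes> p') \<otimes> a"
      using cp(1,2) p' jac_carrier jac_prods_carrier by (auto simp: m_assoc subset_iff)
    moreover have "c \<otimes> p' \<in> jac_prods (Suc n)" using cp(2) p'(2) by auto
    ultimately show ?case using p'(3) by blast
  qed
  then show ?thesis using that by blast
qed

lemma lspan_carrier:
  assumes "K \<subseteq> carrier R" "B \<subseteq> carrier R"
  shows "lspan K B \<subseteq> carrier R"
proof
  fix x assume "x \<in> lspan K B"
  then show "x \<in> carrier R" by induction (use assms in auto)
qed

lemma lspan_add:
  assumes "K \<subseteq> carrier R" "B \<subseteq> carrier R" "x \<in> lspan K B" "y \<in> lspan K B"
  shows "x \<oplus> y \<in> lspan K B"
  using assms(4)
proof induction
  case zero
  then show ?case using assms lspan_carrier[of K B] by auto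
next
  case (add u k b)
  have "x \<oplus> (u \<oplus> k \<otimes> b) = (x \<oplus> u) \<oplus> k \<otimes> b"
    using add assms lspan_carrier[of K B] by (subst a_assoc) auto
  then show ?case using lspan.add[OF add.IH add.hyps(2,3)] by simp
qed

lemma lspan_base:
  assumes "K \<subseteq> carrier R" "B \<subseteq> carrier R" "k \<in> K" "b \<in> B"
  shows "k \<otimes> b \<in> lspan K B"
  using lspan.add[OF lspan.zero assms(3,4)] assms by (auto simp: subset_iff)

lemma lspan_mult:
  assumes "K \<subseteq> carrier R" "B \<subseteq> carrier R" "s \<in> carrier R" "x \<in> lspan K B"
    and "\<And>k. k \<in> K \<Longrightarrow> s \<otimes> k \<in> K"
  shows "s \<otimes> x \<in> lspan K B"
  using assms(4)
proof induction
  case zero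
  then show ?case using assms(3) by (simp add: lspan.zero)
next
  case (add u k b)
  have "s \<otimes> (u \<oplus> k \<otimes> b) = s \<otimes> u \<oplus> (s \<otimes> k) \<otimes> b"
    using add assms(1-3) lspan_carrier[of K B] by (auto simp: r_distr m_assoc subset_iff)
  then show ?case using lspan.add[OF add.IH assms(5)[OF add.hyps(2)] add.hyps(3)] by simp
qed

lemma lspan_minus:
  assumes "K \<subseteq> carrier R" "B \<subseteq> carrier R" "x \<in> lspan K B"
    and "\<And>k s. \<lbrakk>s \<in> carrier R; k \<in> K\<rbrakk> \<Longrightarrow> s \<otimes> k \<in> K"
  shows "\<ominus> x \<in> lspan K B"
proof -
  have "x \<in> carrier R" using assms lspan_carrier by blast
  then have "\<ominus> x = (\<ominus> \<one>) \<otimes> x" by (simp add: l_minus)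
  then show ?thesis using lspan_mult[of K B "\<ominus> \<one>" x] assms by auto
qed

lemma lspan_finsum:
  assumes "K \<subseteq> carrier R" "B \<subseteq> carrier R" "finite F" "F \<subseteq> B" "s \<in> F \<rightarrow> K"
  shows "(\<Oplus>b\<in>F. s b \<otimes> b) \<in> lspan K B"
  using assms(3-5)
proof (induction F)
  case empty
  then show ?case by (simp add: lspan.zero)
next
  case (insert b F)
  have "(\<Oplus>b\<in>insert b F. s b \<otimes> b) = s b \<otimes> b \<oplus> (\<Oplus>b\<in>F. s b \<otimes> b)"
    using insert assms(1,2) by (subst finsum_insert) (auto simp: Pi_iff subset_iff)
  then show ?case
    using insert lspan_base[of K B "s b" b] lspan_add[of K B] assms(1,2) by auto
qed

lemma finsum_extend_zero:
  assumes "finite G" "F \<subseteq> G" "G \<subseteq> carrier R" "s \<in> F \<rightarrow> carrier R"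
  shows "(\<Oplus>b\<in>G. (if b \<in> F then s b else \<zero>) \<otimes> b) = (\<Oplus>b\<in>F. s b \<otimes> b)"
  by (rule add.finprod_mono_neutral_cong_right)
    (use assms in \<open>auto simp: Pi_iff subset_iff\<close>)

text \<open>A generator may occur repeatedly in \<open>lspan\<close>, whereas a sum over a set of
  generators admits it once. Each step of the induction therefore adds \<open>k\<close> to the old
  coefficient of \<open>b\<close>, which counts as zero if \<open>b\<close> is new.\<close>

lemma lspan_carrierE:
  assumes "x \<in> lspan (carrier R) B" "B \<subseteq> carrier R"
  obtains F s where "finite F" "F \<subseteq> B" "s \<in> F \<rightarrow> carrier R" "x = (\<Oplus>b\<in>F. s b \<otimes> b)"
proof -
  have "\<exists>F s. finite F \<and> F \<subseteq> B \<and> s \<in> F \<rightarrow> carrier R \<and> x = (\<Oplus>b\<in>F. s b \<otimes> b)"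
    using assms(1)
  proof induction
    case zero
    show ?case by (rule exI[of _ "{}"]) auto
  next
    case (add u k b)
    then obtain F s where F: "finite F" "F \<subseteq> B" "s \<in> F \<rightarrow> carrier R" "u = (\<Oplus>b\<in>F. s b \<otimes> b)"
      by blast
    have bc: "b \<in> carrier R" using add assms by blast
    let ?c = "\<lambda>c. if c \<in> F then s c else \<zero>"
    let ?s = "\<lambda>c. if c = b then ?c b \<oplus> k else s c"
    have cb: "?c b \<in> carrier R" using F by auto
    have Fc: "F \<subseteq> carrier R" using F(2) assms(2) by blast
    have "u = (\<Oplus>c\<in>insert b F. ?c c \<otimes> c)"
      using F assms add finsum_extend_zero[of "insert b F" F s] by (auto simp: subset_iff)
    also have "\<dots> = (\<Oplus>c\<in>insert b (F - {b}). ?c c \<otimes> c)" by simp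
    also have "\<dots> = ?c b \<otimes> b \<oplus> (\<Oplus>c\<in>F - {b}. ?c c \<otimes> c)"
      by (rule finsum_insert) (use F bc Fc in \<open>auto simp: Pi_iff subset_iff\<close>)
    also have "(\<Oplus>c\<in>F - {b}. ?c c \<otimes> c) = (\<Oplus>c\<in>F - {b}. ?s c \<otimes> c)"
      by (rule finsum_cong') (use F bc Fc in \<open>auto simp: Pi_iff subset_iff\<close>)
    finally have u: "u = ?c b \<otimes> b \<oplus> (\<Oplus>c\<in>F - {b}. ?s c \<otimes> c)" .
    have fs: "(\<Oplus>c\<in>F - {b}. ?s c \<otimes> c) \<in> carrier R"
      by (rule finsum_closed) (use F bc Fc in \<open>auto simp: Pi_iff subset_iff\<close>)
    have "(\<Oplus>c\<in>insert b (F - {b}). ?s c \<otimes> c) = ?s b \<otimes> b \<oplus> (\<Oplus>c\<in>F - {b}. ?s c \<otimes> c)"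
      by (rule finsum_insert) (use F bc Fc cb add(2) in \<open>auto simp: Pi_iff subset_iff\<close>)
    also have "\<dots> = u \<oplus> k \<otimes> b"
      unfolding u using fs cb add(2) bc by (simp add: l_distr a_ac)
    finally have "u \<oplus> k \<otimes> b = (\<Oplus>c\<in>insert b F. ?s c \<otimes> c)" by simp
    moreover have "?s \<in> insert b F \<rightarrow> carrier R" using F cb add(2) by auto
    ultimately show ?case using F add(3) by (intro exI[of _ "insert b F"] exI[of _ ?s]) auto
  qed
  then show ?thesis using that by blast
qed

end

section \<open>Rings with split finite families and minimal principal left ideals\<close>

text \<open>\<open>minimal_principal\<close> is the descending chain condition on principal left
  ideals, phrased for sets of generators: \<open>R(sa)\<close> is not smaller than \<open>Ra\<close>
  as long as \<open>sa\<close> stays in \<open>C\<close>. \<open>split\<close> expresses that the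
  left ideal generated by \<open>F\<close> is projective: sending \<open>c\<close> to the row
  \<open>\<epsilon> c\<close> is a section of the map from the free module on \<open>F\<close>, and
  the clause about relations says that this section is well defined.\<close>

locale split_minimal_ring = ring +
  assumes minimal_principal:
      "\<lbrakk>C \<subseteq> carrier R; C \<noteq> {}\<rbrakk> \<Longrightarrow>
        \<exists>a\<in>C. \<forall>s\<in>carrier R. s \<otimes> a \<in> C \<longrightarrow> (\<exists>t\<in>carrier R. a = t \<otimes> (s \<otimes> a))"
    and split:
      "\<lbrakk>finite F; F \<subseteq> carrier R\<rbrakk> \<Longrightarrow>
        \<exists>\<epsilon>\<in>F \<rightarrow> F \<rightarrow> carrier R. (\<forall>c\<in>F. (\<Oplus>b\<in>F. \<epsilon> c b \<otimes> b) = c) \<and>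
          (\<forall>s\<in>F \<rightarrow> carrier R. (\<Oplus>b\<in>F. s b \<otimes> b) = \<zero> \<longrightarrow> (\<forall>b\<in>F. (\<Oplus>c\<in>F. s c \<otimes> \<epsilon> c b) = \<zero>))"
begin

text \<open>An element \<open>s\<close> kills \<open>b\<close> exactly if it kills \<open>e\<close>,
  so \<open>Rb\<close> is isomorphic to \<open>Re\<close>. Moreover \<open>e\<close> is idempotent,
  because e - 1 kills \<open>b\<close> and therefore \<open>e\<close>.\<close>

lemma split_single:
  assumes b: "b \<in> carrier R"
  obtains e where "e \<in> carrier R" "e \<otimes> b = b"
    "\<And>s. \<lbrakk>s \<in> carrier R; s \<otimes> b = \<zero>\<rbrakk> \<Longrightarrow> s \<otimes> e = \<zero>"
proof -
  obtain \<epsilon> where e: "\<epsilon> \<in> {b} \<rightarrow> {b} \<rightarrow> carrier R" "(\<Oplus>c\<in>{b}. \<epsilon> b c \<otimes> c) = b"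
    and k: "\<forall>s\<in>{b} \<rightarrow> carrier R. (\<Oplus>c\<in>{b}. s c \<otimes> c) = \<zero> \<longrightarrow> (\<Oplus>c\<in>{b}. s c \<otimes> \<epsilon> c b) = \<zero>"
    using split[of "{b}"] b by auto
  have ec: "\<epsilon> b b \<in> carrier R" using e(1) by auto
  show thesis
  proof (rule that[of "\<epsilon> b b"])
    show "\<epsilon> b b \<otimes> b = b" using e(2) ec b by simp
    fix s assume s: "s \<in> carrier R" "s \<otimes> b = \<zero>"
    then show "s \<otimes> \<epsilon> b b = \<zero>" using bspec[OF k, of "\<lambda>_. s"] ec b by simp
  qed (rule ec)
qed

text \<open>It follows that 1 - e generates the left annihilator of \<open>F\<close>. Applying
  \<open>split\<close> to \<open>F\<close> would not give this, since it concerns linear relations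
  between the members of \<open>F\<close> and not the elements that kill all of them at once. Hence
  the induction, which adjoins one member at a time.\<close>

lemma annihilator_finite:
  assumes "finite F" "F \<subseteq> carrier R"
  shows "\<exists>e\<in>carrier R. (\<forall>f\<in>F. e \<otimes> f = f) \<and>
    (\<forall>s\<in>carrier R. (\<forall>f\<in>F. s \<otimes> f = \<zero>) \<longrightarrow> s \<otimes> e = \<zero>)"
  using assms
proof (induction F)
  case empty
  then show ?case by (intro bexI[of _ \<zero>]) auto
next
  case (insert f F)
  then obtain e where e: "e \<in> carrier R" "\<forall>f\<in>F. e \<otimes> f = f"
    "\<forall>s\<in>carrier R. (\<forall>f\<in>F. s \<otimes> f = \<zero>) \<longrightarrow> s \<otimes> e = \<zero>" by auto
  have fc: "f \<in> carrier R" "F \<subseteq> carrier R" using insert by auto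
  let ?g = "f \<ominus> e \<otimes> f"
  have g: "?g \<in> carrier R" using fc e by simp
  obtain e' where e': "e' \<in> carrier R" "e' \<otimes> ?g = ?g"
    "\<And>s. \<lbrakk>s \<in> carrier R; s \<otimes> ?g = \<zero>\<rbrakk> \<Longrightarrow> s \<otimes> e' = \<zero>"
    using split_single[OF g] by blast
  \<comment> \<open>\<open>e'\<close> fixes the part of \<open>f\<close> that \<open>e\<close>
    misses, and the factor 1 - e makes this correction vanish on \<open>F\<close>.\<close>
  let ?h = "e \<oplus> e' \<otimes> (\<one> \<ominus> e)"
  have eq: "?h \<otimes> x = e \<otimes> x \<oplus> e' \<otimes> (x \<ominus> e \<otimes> x)" if "x \<in> carrier R" for x
    using that e(1) e'(1) by (simp add: l_distr m_assoc minus_eq l_minus)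
  have "?h \<otimes> x = x" if "x \<in> insert f F" for x
  proof (cases "x = f")
    case True
    then show ?thesis
      using eq[of f] fc(1) e(1) e'(2) by (simp add: minus_eq a_ac r_neg)
  next
    case False
    then have "x \<in> F" "x \<in> carrier R" using that fc by auto
    then show ?thesis using eq[of x] e e'(1) by (simp add: minus_eq r_neg)
  qed
  moreover have "s \<otimes> ?h = \<zero>" if s: "s \<in> carrier R" "\<forall>x\<in>insert f F. s \<otimes> x = \<zero>" for s
  proof -
    have se: "s \<otimes> e = \<zero>" using e(3) s by auto
    then have "s \<otimes> ?g = \<zero>"
      using s fc e(1) by (simp add: minus_eq r_distr r_minus m_assoc[symmetric])
    then have "s \<otimes> e' = \<zero>" using e'(3) s by blast
    then show ?thesis using se s e(1) e'(1) by (simp add: r_distr m_assoc[symmetric])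
  qed
  ultimately show ?case using e(1) e'(1) by (intro bexI[of _ ?h]) auto
qed

text \<open>The left annihilators of finite subsets of \<open>T\<close> are principal and shrink as
  the subset grows. For a minimal one, adjoining any further \<open>f\<close> from \<open>T\<close>
  changes nothing, so it already annihilates all of \<open>T\<close>.\<close>

lemma annihilator_principal:
  assumes T: "T \<subseteq> carrier R"
  shows "\<exists>a\<in>carrier R. \<forall>s\<in>carrier R. (\<forall>f\<in>T. s \<otimes> f = \<zero>) \<longleftrightarrow> (\<exists>t\<in>carrier R. s = t \<otimes> a)"
proof -
  define P where
    "P F a \<longleftrightarrow> (\<forall>s\<in>carrier R. (\<forall>f\<in>F. s \<otimes> f = \<zero>) \<longleftrightarrow> (\<exists>t\<in>carrier R. s = t \<otimes> a))" for F a
  have P_kills: "a \<otimes> f = \<zero>" if "a \<in> carrier R" "P F a" "f \<in> F" for F a f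
  proof -
    have "\<exists>t\<in>carrier R. a = t \<otimes> a" using that(1) by (intro bexI[of _ \<one>]) auto
    then show ?thesis using that unfolding P_def by blast
  qed
  have ex: "\<exists>a\<in>carrier R. P F a" if F: "finite F" "F \<subseteq> T" for F
  proof -
    have Fc: "F \<subseteq> carrier R" using F T by blast
    obtain e where e: "e \<in> carrier R" "\<forall>f\<in>F. e \<otimes> f = f"
      "\<forall>s\<in>carrier R. (\<forall>f\<in>F. s \<otimes> f = \<zero>) \<longrightarrow> s \<otimes> e = \<zero>"
      using annihilator_finite[OF F(1) Fc] by blast
    have "P F (\<one> \<ominus> e)"
      unfolding P_def
    proof (intro ballI iffI)
      fix s assume s: "s \<in> carrier R" "\<forall>f\<in>F. s \<otimes> f = \<zero>"
      then have "s = s \<otimes> (\<one> \<ominus> e)" using e by (simp add: minus_eq r_distr r_minus)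
      then show "\<exists>t\<in>carrier R. s = t \<otimes> (\<one> \<ominus> e)" using s by blast
    next
      fix s f assume "s \<in> carrier R" "\<exists>t\<in>carrier R. s = t \<otimes> (\<one> \<ominus> e)" and f: "f \<in> F"
      then obtain t where t: "t \<in> carrier R" "s = t \<otimes> (\<one> \<ominus> e)" by blast
      have "f \<in> carrier R" using f Fc by blast
      moreover have "(\<one> \<ominus> e) \<otimes> f = \<zero>"
        using e f \<open>f \<in> carrier R\<close> by (simp add: minus_eq l_distr l_minus r_neg)
      ultimately show "s \<otimes> f = \<zero>" using t e(1) by (simp add: m_assoc)
    qed
    then show ?thesis using e(1) by blast
  qed
  let ?C = "{a \<in> carrier R. \<exists>F. finite F \<and> F \<subseteq> T \<and> P F a}"
  obtain a\<^sub>0 where "a\<^sub>0 \<in> carrier R" "P {} a\<^sub>0" using ex[of "{}"] by blast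
  then have "a\<^sub>0 \<in> ?C" by blast
  then have "?C \<noteq> {}" by blast
  moreover have "?C \<subseteq> carrier R" by blast
  ultimately obtain a where aC: "a \<in> ?C"
    and min: "\<forall>s\<in>carrier R. s \<otimes> a \<in> ?C \<longrightarrow> (\<exists>t\<in>carrier R. a = t \<otimes> (s \<otimes> a))"
    using minimal_principal by meson
  from aC obtain F where a: "a \<in> carrier R" "finite F" "F \<subseteq> T" "P F a" by blast
  have "a \<otimes> f = \<zero>" if f: "f \<in> T" for f
  proof -
    obtain a' where a': "a' \<in> carrier R" "P (insert f F) a'"
      using ex[of "insert f F"] a f by auto
    have kill: "\<forall>g\<in>insert f F. a' \<otimes> g = \<zero>"
      using P_kills a' by blast
    then obtain s where s: "s \<in> carrier R" "a' = s \<otimes> a"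
      using a(4) a'(1) unfolding P_def by blast
    moreover have "a' \<in> ?C" using a' a f by (auto intro!: exI[of _ "insert f F"])
    ultimately obtain t where "t \<in> carrier R" "a = t \<otimes> a'" using bspec[OF min, of s] by auto
    then show ?thesis using kill a'(1) f T by (auto simp: m_assoc subset_iff)
  qed
  then have "P T a"
    using a T unfolding P_def by (auto simp: m_assoc subset_iff)
  then show ?thesis using a(1) unfolding P_def by blast
qed

text \<open>The right annihilators \<open>r n\<close> of the powers of the radical increase, so
  their left annihilators decrease. The latter are principal, so the chain condition makes two
  consecutive ones agree, and going back to right annihilators gives \<open>r (Suc n) = r n\<close>.
  If \<one> were outside this set, an element \<open>b\<close> outside it with minimal
  \<open>Rb\<close> would satisfy b = u j b with j in the radical, and would vanish.\<close>

lemma jac_nilpotent: "\<exists>n. jac_prods n \<subseteq> {\<zero>}"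
proof -
  define r where "r n = {x \<in> carrier R. \<forall>q\<in>jac_prods n. q \<otimes> x = \<zero>}" for n
  define L where "L n a \<longleftrightarrow> (\<forall>s\<in>carrier R. (\<forall>x\<in>r n. s \<otimes> x = \<zero>) \<longleftrightarrow> (\<exists>t\<in>carrier R. s = t \<otimes> a))"
    for n a
  have r_carrier: "r n \<subseteq> carrier R" for n by (auto simp: r_def)
  have ex: "\<exists>a\<in>carrier R. L n a" for n
    using annihilator_principal[OF r_carrier] unfolding L_def .
  have r_mono: "r n \<subseteq> r (Suc n)" for n
    using jac_carrier jac_prods_carrier by (fastforce simp: r_def m_assoc subset_iff)
  let ?C = "{a \<in> carrier R. \<exists>n. L n a}"
  have "?C \<noteq> {}" using ex[of 0] by auto
  then obtain a n where a: "a \<in> carrier R" "L n a"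
    and min: "\<And>s. \<lbrakk>s \<in> carrier R; s \<otimes> a \<in> ?C\<rbrakk> \<Longrightarrow> \<exists>t\<in>carrier R. a = t \<otimes> (s \<otimes> a)"
    using minimal_principal[of ?C] by blast
  obtain a' where a': "a' \<in> carrier R" "L (Suc n) a'" using ex by blast
  have kill': "\<forall>x\<in>r (Suc n). a' \<otimes> x = \<zero>"
    using a' unfolding L_def by (metis l_one one_closed)
  then have "\<forall>x\<in>r n. a' \<otimes> x = \<zero>" using r_mono by blast
  then obtain s where s: "s \<in> carrier R" "a' = s \<otimes> a"
    using a(2) a'(1) unfolding L_def by blast
  then obtain t where t: "t \<in> carrier R" "a = t \<otimes> a'" using min[of s] a' by blast
  have kill: "a \<otimes> x = \<zero>" if "x \<in> r (Suc n)" for x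
    using kill' that t a'(1) r_carrier by (auto simp: m_assoc subset_iff)
  \<comment> \<open>Each product \<open>q\<close> of length \<open>n\<close> annihilates
    \<open>r n\<close> and is therefore a left multiple of \<open>a\<close>, which annihilates even
    \<open>r (Suc n)\<close>.\<close>
  have stable: "r (Suc n) \<subseteq> r n"
  proof
    fix x assume x: "x \<in> r (Suc n)"
    then have xc: "x \<in> carrier R" using r_carrier by blast
    have "q \<otimes> x = \<zero>" if q: "q \<in> jac_prods n" for q
    proof -
      have qc: "q \<in> carrier R" using q jac_prods_carrier by blast
      have "\<forall>y\<in>r n. q \<otimes> y = \<zero>" using q by (simp add: r_def)
      then obtain u where "u \<in> carrier R" "q = u \<otimes> a" using a(2) qc unfolding L_def by blast
      then show ?thesis using kill[OF x] a(1) xc by (simp add: m_assoc)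
    qed
    then show "x \<in> r n" using xc by (simp add: r_def)
  qed
  have "\<one> \<in> r n"
  proof (rule ccontr)
    assume "\<one> \<notin> r n"
    then obtain b where b: "b \<in> carrier R - r n"
      and bmin: "\<And>s. \<lbrakk>s \<in> carrier R; s \<otimes> b \<in> carrier R - r n\<rbrakk> \<Longrightarrow>
        \<exists>t\<in>carrier R. b = t \<otimes> (s \<otimes> b)"
      using minimal_principal[of "carrier R - r n"] by auto
    have "b \<notin> r (Suc n)" using b stable by blast
    then obtain q where q: "q \<in> jac_prods (Suc n)" "q \<otimes> b \<noteq> \<zero>" using b by (auto simp: r_def)
    \<comment> \<open>The last factor is split off, not the first: the remaining \<open>p\<close> of
      length \<open>n\<close> then witnesses that \<open>j \<otimes> b\<close> is still outside
      \<open>r n\<close>.\<close>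
    then obtain p j where pj: "q = p \<otimes> j" "p \<in> jac_prods n" "j \<in> jac"
      using jac_prods_Suc_rightE by blast
    have c: "p \<in> carrier R" "j \<in> carrier R"
      using pj jac_carrier jac_prods_carrier by blast+
    have "p \<otimes> (j \<otimes> b) \<noteq> \<zero>" using q(2) pj(1) c b by (simp add: m_assoc)
    then have "j \<otimes> b \<in> carrier R - r n" using pj(2) c b by (auto simp: r_def)
    then obtain u where "u \<in> carrier R" "b = u \<otimes> (j \<otimes> b)" using bmin[OF c(2)] by blast
    then have "b = \<zero>" using jac_fixed_zero[OF pj(3)] b by blast
    then show False using \<open>p \<otimes> (j \<otimes> b) \<noteq> \<zero>\<close> c by simp
  qed
  then show ?thesis
    using jac_prods_carrier by (intro exI[of _ n]) (fastforce simp: r_def subset_iff)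
qed

section \<open>Independence modulo the radical and minimal generators\<close>

text \<open>The family is independent modulo the radical \<open>J I\<close> of \<open>I\<close>, up to the radicals
  \<open>J b\<close> of its members.\<close>

definition jac_independent :: "'a set \<Rightarrow> 'a set \<Rightarrow> bool"
  where "jac_independent I B \<longleftrightarrow> B \<subseteq> I \<and>
    (\<forall>F s. finite F \<longrightarrow> F \<subseteq> B \<longrightarrow> s \<in> F \<rightarrow> carrier R \<longrightarrow> (\<Oplus>b\<in>F. s b \<otimes> b) \<in> lspan jac I \<longrightarrow>
      (\<forall>b\<in>F. \<exists>j\<in>jac. s b \<otimes> b = j \<otimes> b))"

text \<open>Each instance of independence involves a finite subfamily, so the property passes to
  unions of chains and Zorn's lemma applies.\<close>

lemma jac_independent_maximal:
  "\<exists>B. jac_independent I B \<and> (\<forall>B'. jac_independent I B' \<longrightarrow> B \<subseteq> B' \<longrightarrow> B' = B)"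
proof -
  have "\<exists>M\<in>{B. jac_independent I B}. \<forall>X\<in>{B. jac_independent I B}. M \<subseteq> X \<longrightarrow> X = M"
  proof (rule subset_Zorn_nonempty)
    show "{B. jac_independent I B} \<noteq> {}"
      by (auto simp: jac_independent_def intro!: exI[of _ "{}"])
    fix \<C> assume C: "\<C> \<noteq> {}" "subset.chain {B. jac_independent I B} \<C>"
    have "\<Union> \<C> \<subseteq> I" using C(2) by (auto simp: subset.chain_def jac_independent_def)
    moreover have "\<exists>j\<in>jac. s b \<otimes> b = j \<otimes> b"
      if "finite F" "F \<subseteq> \<Union> \<C>" "s \<in> F \<rightarrow> carrier R" "(\<Oplus>b\<in>F. s b \<otimes> b) \<in> lspan jac I" "b \<in> F" for F s b
    proof -
      obtain B where "B \<in> \<C>" "F \<subseteq> B"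
        using finite_subset_Union_chain[OF \<open>finite F\<close> \<open>F \<subseteq> \<Union> \<C>\<close> C] by blast
      then show ?thesis using C(2) that by (auto simp: subset.chain_def jac_independent_def)
    qed
    ultimately show "\<Union> \<C> \<in> {B. jac_independent I B}" by (simp add: jac_independent_def)
  qed
  then show ?thesis by auto
qed

text \<open>An element \<open>b\<close> with \<open>Rb\<close> minimal among the principal left ideals not contained in \<open>W\<close>
  generates a projective module with \<open>Rb \<inter> W\<close> as its only maximal submodule.\<close>

lemma minimal_generator_jac:
  assumes b: "b \<in> carrier R" "b \<notin> W" and W: "W \<subseteq> carrier R"
    and W_add: "\<And>x y. \<lbrakk>x \<in> W; y \<in> W\<rbrakk> \<Longrightarrow> x \<oplus> y \<in> W"
    and W_mult: "\<And>s x. \<lbrakk>s \<in> carrier R; x \<in> W\<rbrakk> \<Longrightarrow> s \<otimes> x \<in> W"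
    and min: "\<And>s. \<lbrakk>s \<in> carrier R; s \<otimes> b \<notin> W\<rbrakk> \<Longrightarrow> \<exists>t\<in>carrier R. b = t \<otimes> (s \<otimes> b)"
    and s: "s \<in> carrier R" "s \<otimes> b \<in> W"
  shows "\<exists>j\<in>jac. s \<otimes> b = j \<otimes> b"
proof -
  obtain e where e: "e \<in> carrier R" "e \<otimes> b = b"
    and ann: "\<And>s. \<lbrakk>s \<in> carrier R; s \<otimes> b = \<zero>\<rbrakk> \<Longrightarrow> s \<otimes> e = \<zero>"
    using split_single[OF b(1)] by blast
  have cancel: "x \<otimes> e = y \<otimes> e" if "x \<in> carrier R" "y \<in> carrier R" "x \<otimes> b = y \<otimes> b" for x y
  proof -
    have "(x \<ominus> y) \<otimes> e = \<zero>"
      by (rule ann) (use that b in \<open>simp_all add: minus_eq l_distr l_minus r_neg\<close>)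
    then have "x \<otimes> e \<ominus> y \<otimes> e = \<zero>"
      using that e(1) by (simp add: minus_eq l_distr l_minus)
    then show ?thesis using that e(1) by (simp add: diff_zero_imp_eq)
  qed
  have idem: "e \<otimes> e = e" using cancel[of e \<one>] e b by simp
  \<comment> \<open>This is the witness \<open>j\<close>, since \<open>e \<otimes> b = b\<close>.
    The element \<open>s\<close> matters only up to the left annihilator of \<open>b\<close>, and
    multiplication by \<open>e\<close> removes that freedom.\<close>
  have "s \<otimes> e \<in> jac"
    unfolding jac_def
  proof (intro CollectI conjI ballI)
    fix t assume t: "t \<in> carrier R"
    let ?y = "t \<otimes> (s \<otimes> e)"
    have y: "?y \<in> carrier R" using t s e by simp
    have ye: "?y \<otimes> e = ?y" using t s e idem by (simp add: m_assoc)
    have yb: "?y \<otimes> b = t \<otimes> (s \<otimes> b)" using t s e b by (simp add: m_assoc)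
    then have eyb: "e \<otimes> (?y \<otimes> b) \<in> W" using W_mult t s e by simp
    \<comment> \<open>The leading factor \<open>e\<close> is chosen so that \<open>?z\<close> equals
      e(1 - y). Cancelling \<open>b\<close> in b = v z b then yields a product with 1 - y itself,
      namely (v e)(1 - y) = e.\<close>
    let ?z = "e \<ominus> e \<otimes> ?y"
    have zb: "?z \<otimes> b = b \<ominus> e \<otimes> (?y \<otimes> b)"
      using y e b by (simp add: minus_eq l_distr l_minus m_assoc)
    have "?z \<otimes> b \<notin> W"
    proof
      assume "?z \<otimes> b \<in> W"
      then have "?z \<otimes> b \<oplus> e \<otimes> (?y \<otimes> b) \<in> W" using W_add eyb by blast
      moreover have "?z \<otimes> b \<oplus> e \<otimes> (?y \<otimes> b) = b"
        unfolding zb using y e b by (simp add: minus_eq a_assoc l_neg del: m_assoc)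
      ultimately show False using b by simp
    qed
    then obtain v where v: "v \<in> carrier R" "b = v \<otimes> (?z \<otimes> b)" using min[of ?z] y e by auto
    have "\<one> \<otimes> e = (v \<otimes> ?z) \<otimes> e"
      by (rule cancel) (use v y e b in \<open>simp_all add: m_assoc\<close>)
    also have "\<dots> = (v \<otimes> e) \<otimes> (\<one> \<ominus> ?y)"
    proof -
      have "?z \<otimes> e = ?z" using y e idem ye by (simp add: minus_eq l_distr l_minus m_assoc)
      moreover have "?z = e \<otimes> (\<one> \<ominus> ?y)" using y e by (simp add: minus_eq r_distr r_minus)
      ultimately show ?thesis using v y e by (simp add: m_assoc)
    qed
    finally have ve: "(v \<otimes> e) \<otimes> (\<one> \<ominus> ?y) = e" using e by simp
    \<comment> \<open>As y e = y, a left inverse of 1 - y relative to \<open>e\<close> extends to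
      one relative to \<one>: the product is (1 - y) + y e = 1.\<close>
    have "(\<one> \<oplus> ?y \<otimes> (v \<otimes> e)) \<otimes> (\<one> \<ominus> ?y) = (\<one> \<ominus> ?y) \<oplus> ?y \<otimes> ((v \<otimes> e) \<otimes> (\<one> \<ominus> ?y))"
      using y v(1) e(1) by (simp add: l_distr m_assoc)
    also have "\<dots> = (\<one> \<ominus> ?y) \<oplus> ?y" unfolding ve ye ..
    also have "\<dots> = \<one>" using y by (simp add: minus_eq a_assoc l_neg)
    finally show "\<exists>u\<in>carrier R. u \<otimes> (\<one> \<ominus> ?y) = \<one>" using y v(1) e(1) by blast
  qed (use s e in simp)
  moreover have "s \<otimes> b = (s \<otimes> e) \<otimes> b" using s e b by (simp add: m_assoc)
  ultimately show ?thesis by blast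
qed

end

section \<open>Left ideals with an independent generating family\<close>

lemma (in left_module) smult_left_zero:
  assumes "x \<in> carrier M"
  shows "\<zero> \<odot>\<^bsub>M\<^esub> x = \<zero>\<^bsub>M\<^esub>"
proof -
  have c: "\<zero> \<odot>\<^bsub>M\<^esub> x \<in> carrier M" using assms smult_closed by simp
  have "\<zero> \<odot>\<^bsub>M\<^esub> x \<oplus>\<^bsub>M\<^esub> \<zero> \<odot>\<^bsub>M\<^esub> x = \<zero> \<odot>\<^bsub>M\<^esub> x"
    using smult_l_distr[of \<zero> \<zero> x] assms by simp
  then show ?thesis using c by (metis M.add.l_cancel_one')
qed

lemma (in left_module) smult_right_zero:
  assumes "a \<in> carrier R"
  shows "a \<odot>\<^bsub>M\<^esub> \<zero>\<^bsub>M\<^esub> = \<zero>\<^bsub>M\<^esub>"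
proof -
  have c: "a \<odot>\<^bsub>M\<^esub> \<zero>\<^bsub>M\<^esub> \<in> carrier M" using assms smult_closed by simp
  have "a \<odot>\<^bsub>M\<^esub> \<zero>\<^bsub>M\<^esub> \<oplus>\<^bsub>M\<^esub> a \<odot>\<^bsub>M\<^esub> \<zero>\<^bsub>M\<^esub> = a \<odot>\<^bsub>M\<^esub> \<zero>\<^bsub>M\<^esub>"
    using smult_r_distr[of a "\<zero>\<^bsub>M\<^esub>" "\<zero>\<^bsub>M\<^esub>"] assms by simp
  then show ?thesis using c by (metis M.add.l_cancel_one')
qed

lemma (in left_module) smult_finsum:
  assumes "finite F" "a \<in> carrier R" "v \<in> F \<rightarrow> carrier M"
  shows "a \<odot>\<^bsub>M\<^esub> (\<Oplus>\<^bsub>M\<^esub>b\<in>F. v b) = (\<Oplus>\<^bsub>M\<^esub>b\<in>F. a \<odot>\<^bsub>M\<^esub> v b)"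
  using assms
proof (induction F)
  case empty
  then show ?case by (simp add: smult_right_zero)
next
  case (insert b F)
  have "a \<odot>\<^bsub>M\<^esub> (\<Oplus>\<^bsub>M\<^esub>b\<in>insert b F. v b) = a \<odot>\<^bsub>M\<^esub> (v b \<oplus>\<^bsub>M\<^esub> (\<Oplus>\<^bsub>M\<^esub>b\<in>F. v b))"
    using insert by (subst M.finsum_insert) auto
  also have "\<dots> = a \<odot>\<^bsub>M\<^esub> v b \<oplus>\<^bsub>M\<^esub> (\<Oplus>\<^bsub>M\<^esub>b\<in>F. a \<odot>\<^bsub>M\<^esub> v b)"
    using insert by (subst smult_r_distr) (auto intro!: M.finsum_closed)
  also have "\<dots> = (\<Oplus>\<^bsub>M\<^esub>b\<in>insert b F. a \<odot>\<^bsub>M\<^esub> v b)"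
    using insert by (subst M.finsum_insert) (auto intro!: smult_closed)
  finally show ?case .
qed

lemma mod_hom_finsum:
  assumes "abelian_group M" "abelian_group N" "f \<in> mod_hom R M N" "finite F" "v \<in> F \<rightarrow> carrier M"
  shows "f (\<Oplus>\<^bsub>M\<^esub>b\<in>F. v b) = (\<Oplus>\<^bsub>N\<^esub>b\<in>F. f (v b))"
proof -
  interpret M: abelian_group M by fact
  interpret N: abelian_group N by fact
  have fc: "f x \<in> carrier N" if "x \<in> carrier M" for x using assms(3) that by (auto simp: mod_hom_def)
  have fa: "f (x \<oplus>\<^bsub>M\<^esub> y) = f x \<oplus>\<^bsub>N\<^esub> f y" if "x \<in> carrier M" "y \<in> carrier M" for x y
    using assms(3) that by (auto simp: mod_hom_def)
  have f0: "f \<zero>\<^bsub>M\<^esub> = \<zero>\<^bsub>N\<^esub>"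
    using fa[of "\<zero>\<^bsub>M\<^esub>" "\<zero>\<^bsub>M\<^esub>"] fc[of "\<zero>\<^bsub>M\<^esub>"] by (metis M.add.l_one M.zero_closed N.add.l_cancel_one')
  show ?thesis
    using assms(4,5)
  proof (induction F)
    case empty
    then show ?case by (simp add: f0)
  next
    case (insert b F)
    then have v: "v b \<in> carrier M" "v \<in> F \<rightarrow> carrier M" by auto
    then have "(\<lambda>b. f (v b)) \<in> F \<rightarrow> carrier N" using fc by auto
    then show ?case using insert v fa fc by simp
  qed
qed

context ring
begin

lemma left_ideal_facts:
  assumes "left_ideal I R"
  shows "I \<subseteq> carrier R" "\<zero> \<in> I"
    "\<And>x y. \<lbrakk>x \<in> I; y \<in> I\<rbrakk> \<Longrightarrow> x \<oplus> y \<in> I"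
    "\<And>s x. \<lbrakk>s \<in> carrier R; x \<in> I\<rbrakk> \<Longrightarrow> s \<otimes> x \<in> I"
proof -
  interpret I: additive_subgroup I R using assms by (simp add: left_ideal_def)
  show "I \<subseteq> carrier R" by (rule I.a_subset)
  show "\<zero> \<in> I" by (rule I.zero_closed)
  show "\<And>x y. \<lbrakk>x \<in> I; y \<in> I\<rbrakk> \<Longrightarrow> x \<oplus> y \<in> I" by (rule I.a_closed)
  show "\<And>s x. \<lbrakk>s \<in> carrier R; x \<in> I\<rbrakk> \<Longrightarrow> s \<otimes> x \<in> I" using assms by (simp add: left_ideal_def)
qed

text \<open>Here \<open>I\<close> is the direct sum of the modules \<open>Rb\<close>, each
  isomorphic to a direct summand \<open>Re\<close> of the ring. The lift is defined on generators
  and extended through coefficients; independence makes the values on the summands compatible, and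
  \<open>single\<close> makes them well defined on each summand.\<close>

lemma projective_of_independent:
  fixes I :: "'a set"
  assumes I: "left_ideal I R" and B: "B \<subseteq> I" and gen: "I \<subseteq> lspan (carrier R) B"
    and indep: "\<And>F s b. \<lbrakk>finite F; F \<subseteq> B; s \<in> F \<rightarrow> carrier R; (\<Oplus>b\<in>F. s b \<otimes> b) = \<zero>; b \<in> F\<rbrakk> \<Longrightarrow>
      s b \<otimes> b = \<zero>"
    and single: "\<And>b. b \<in> B \<Longrightarrow> \<exists>e\<in>carrier R. e \<otimes> b = b \<and>
      (\<forall>s\<in>carrier R. s \<otimes> b = \<zero> \<longrightarrow> s \<otimes> e = \<zero>)"
  shows "projective TYPE('m) TYPE('n) R (left_ideal_module R I)"
  unfolding projective_def
proof (intro conjI allI impI ballI)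
  show lmI: "left_module R (left_ideal_module R I)"
    by (rule left_module_left_ideal_module[OF ring_axioms I])
  fix M :: "('a, 'm) module" and N :: "('a, 'n) module" and g f
  assume M: "left_module R M" and N: "left_module R N"
    and g: "g \<in> mod_hom R M N" "g ` carrier M = carrier N"
    and f: "f \<in> mod_hom R (left_ideal_module R I) N"
  interpret M: left_module R M by fact
  interpret N: left_module R N by fact
  note Icl = left_ideal_facts[OF I]
  have Bc: "B \<subseteq> carrier R" using B Icl(1) by blast
  have f_closed: "f x \<in> carrier N" if "x \<in> I" for x
    using f that by (auto simp: mod_hom_def left_ideal_module_def)
  have f_add: "f (x \<oplus> y) = f x \<oplus>\<^bsub>N\<^esub> f y" if "x \<in> I" "y \<in> I" for x y
    using f that by (auto simp: mod_hom_def left_ideal_module_def)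
  have f_mult: "f (s \<otimes> x) = s \<odot>\<^bsub>N\<^esub> f x" if "s \<in> carrier R" "x \<in> I" for s x
    using f that by (auto simp: mod_hom_def left_ideal_module_def)
  have f_zero: "f \<zero> = \<zero>\<^bsub>N\<^esub>"
    using f_mult[of \<zero> \<zero>] Icl(2) f_closed N.smult_left_zero by simp
  have g_closed: "g x \<in> carrier N" if "x \<in> carrier M" for x
    using g(1) that by (auto simp: mod_hom_def)
  have g_mult: "g (s \<odot>\<^bsub>M\<^esub> x) = s \<odot>\<^bsub>N\<^esub> g x" if "s \<in> carrier R" "x \<in> carrier M" for s x
    using g(1) that by (auto simp: mod_hom_def)
  have "\<forall>b\<in>B. \<exists>e. e \<in> carrier R \<and> e \<otimes> b = b \<and>
      (\<forall>s\<in>carrier R. s \<otimes> b = \<zero> \<longrightarrow> s \<otimes> e = \<zero>)"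
    using single unfolding Bex_def by blast
  then obtain e where "\<forall>b\<in>B. e b \<in> carrier R \<and> e b \<otimes> b = b \<and>
      (\<forall>s\<in>carrier R. s \<otimes> b = \<zero> \<longrightarrow> s \<otimes> e b = \<zero>)"
    by (rule bchoice[THEN exE])
  then have e: "\<And>b. b \<in> B \<Longrightarrow> e b \<in> carrier R" "\<And>b. b \<in> B \<Longrightarrow> e b \<otimes> b = b"
    "\<And>b s. \<lbrakk>b \<in> B; s \<in> carrier R; s \<otimes> b = \<zero>\<rbrakk> \<Longrightarrow> s \<otimes> e b = \<zero>"
    by blast+
  have "\<exists>m. \<forall>b\<in>B. m b \<in> carrier M \<and> g (m b) = f b"
  proof (rule bchoice, intro ballI)
    fix b assume "b \<in> B"
    then have "f b \<in> g ` carrier M" using f_closed B g(2) by blast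
    then show "\<exists>m. m \<in> carrier M \<and> g m = f b" by force
  qed
  then obtain m where m: "\<And>b. b \<in> B \<Longrightarrow> m b \<in> carrier M" "\<And>b. b \<in> B \<Longrightarrow> g (m b) = f b"
    by blast
  \<comment> \<open>An arbitrary preimage \<open>m b\<close> of \<open>f b\<close> need not be
    killed by the left annihilator of \<open>b\<close>. Its multiple by \<open>e b\<close> is, and
    it still lies over \<open>f b\<close> because \<open>e b \<otimes> b = b\<close>.\<close>
  define n where "n b = e b \<odot>\<^bsub>M\<^esub> m b" for b
  have nc: "n b \<in> carrier M" if "b \<in> B" for b
    using that e m M.smult_closed by (simp add: n_def)
  have gn: "g (n b) = f b" if "b \<in> B" for b
  proof -
    have "b \<in> I" using that B by blast
    then show ?thesis
      using that e(1,2)[OF that] m[OF that] g_mult f_mult[of "e b" b] by (simp add: n_def)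
  qed
  have smult_n: "s \<odot>\<^bsub>M\<^esub> n b = t \<odot>\<^bsub>M\<^esub> n b"
    if b: "b \<in> B" and st: "s \<in> carrier R" "t \<in> carrier R" "(s \<ominus> t) \<otimes> b = \<zero>" for s t b
  proof -
    have ec: "e b \<in> carrier R" by (rule e(1)[OF b])
    have "s \<ominus> t \<in> carrier R" using st(1,2) by simp
    then have z: "(s \<ominus> t) \<otimes> e b = \<zero>" by (rule e(3)[OF b _ st(3)])
    have "(s \<ominus> t) \<otimes> e b = s \<otimes> e b \<ominus> t \<otimes> e b"
      using ec st(1,2) by (simp add: minus_eq l_distr l_minus)
    then have eq: "s \<otimes> e b = t \<otimes> e b"
      using ec st(1,2) z diff_zero_imp_eq[of "s \<otimes> e b" "t \<otimes> e b"] by simp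
    show ?thesis
      unfolding n_def M.smult_assoc[OF st(1) e(1)[OF b] m(1)[OF b], symmetric]
        M.smult_assoc[OF st(2) e(1)[OF b] m(1)[OF b], symmetric] eq ..
  qed
  have well_defined: "(\<Oplus>\<^bsub>M\<^esub>b\<in>G. s b \<odot>\<^bsub>M\<^esub> n b) = (\<Oplus>\<^bsub>M\<^esub>b\<in>G. t b \<odot>\<^bsub>M\<^esub> n b)"
    if G: "finite G" "G \<subseteq> B" and s: "s \<in> G \<rightarrow> carrier R" and t: "t \<in> G \<rightarrow> carrier R"
      and eq: "(\<Oplus>b\<in>G. s b \<otimes> b) = (\<Oplus>b\<in>G. t b \<otimes> b)" for G s t
  proof -
    have Gc: "G \<subseteq> carrier R" using G Bc by blast
    have st: "(\<lambda>b. s b \<ominus> t b) \<in> G \<rightarrow> carrier R" using s t by (auto simp: Pi_iff)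
    have "(\<Oplus>b\<in>G. (s b \<ominus> t b) \<otimes> b) \<oplus> (\<Oplus>b\<in>G. t b \<otimes> b) = (\<Oplus>b\<in>G. (s b \<ominus> t b) \<otimes> b \<oplus> t b \<otimes> b)"
      by (rule finsum_addf[symmetric]) (use Gc s t in \<open>auto simp: Pi_iff subset_iff\<close>)
    also have "\<dots> = (\<Oplus>b\<in>G. s b \<otimes> b)"
    proof (rule finsum_cong')
      fix b assume b: "b \<in> G"
      then have "s b \<in> carrier R" "t b \<in> carrier R" "b \<in> carrier R" using s t Gc by auto
      then show "(s b \<ominus> t b) \<otimes> b \<oplus> t b \<otimes> b = s b \<otimes> b"
        by (simp add: minus_eq l_distr l_minus a_assoc l_neg)
    qed (use Gc s t in \<open>auto simp: Pi_iff subset_iff\<close>)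
    finally have *: "(\<Oplus>b\<in>G. (s b \<ominus> t b) \<otimes> b) \<oplus> (\<Oplus>b\<in>G. t b \<otimes> b) = (\<Oplus>b\<in>G. t b \<otimes> b)"
      using eq by simp
    have "(\<Oplus>b\<in>G. (s b \<ominus> t b) \<otimes> b) \<in> carrier R" "(\<Oplus>b\<in>G. t b \<otimes> b) \<in> carrier R"
      using Gc s t by (auto intro!: finsum_closed simp: Pi_iff subset_iff)
    then have z: "(\<Oplus>b\<in>G. (s b \<ominus> t b) \<otimes> b) = \<zero>" using * by simp
    have "(s b \<ominus> t b) \<otimes> b = \<zero>" if "b \<in> G" for b
      using indep[OF G st z that] .
    then show ?thesis
      using s t G nc by (intro M.finsum_cong') (auto simp: Pi_iff subset_iff intro!: smult_n M.smult_closed)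
  qed
  \<comment> \<open>The coefficient functions are made total, with value \<zero> off the support, so
    that elements with different supports can be compared over one finite set.\<close>
  have "\<exists>F s. finite F \<and> F \<subseteq> B \<and> (\<forall>b. s b \<in> carrier R) \<and> (\<forall>b. b \<notin> F \<longrightarrow> s b = \<zero>) \<and>
      x = (\<Oplus>b\<in>F. s b \<otimes> b)" if x: "x \<in> I" for x
  proof -
    have "x \<in> lspan (carrier R) B" using x gen by blast
    then obtain F s where F: "finite F" "F \<subseteq> B" "s \<in> F \<rightarrow> carrier R" "x = (\<Oplus>b\<in>F. s b \<otimes> b)"
      using lspan_carrierE[OF _ Bc] by blast
    have Fc: "F \<subseteq> carrier R" using F(2) Bc by blast
    have "x = (\<Oplus>b\<in>F. (if b \<in> F then s b else \<zero>) \<otimes> b)"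
      using finsum_extend_zero[OF F(1) subset_refl Fc F(3)] F(4) by simp
    then show ?thesis
      using F(1-3) by (intro exI[of _ F] exI[of _ "\<lambda>b. if b \<in> F then s b else \<zero>"]) auto
  qed
  then have "\<forall>x\<in>I. \<exists>Fs. finite (fst Fs) \<and> fst Fs \<subseteq> B \<and> (\<forall>b. snd Fs b \<in> carrier R) \<and>
      (\<forall>b. b \<notin> fst Fs \<longrightarrow> snd Fs b = \<zero>) \<and> x = (\<Oplus>b\<in>fst Fs. snd Fs b \<otimes> b)"
    by auto
  then obtain rep where rep: "\<forall>x\<in>I. finite (fst (rep x)) \<and> fst (rep x) \<subseteq> B \<and>
      (\<forall>b. snd (rep x) b \<in> carrier R) \<and>
      (\<forall>b. b \<notin> fst (rep x) \<longrightarrow> snd (rep x) b = \<zero>) \<and> x = (\<Oplus>b\<in>fst (rep x). snd (rep x) b \<otimes> b)"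
    by (rule bchoice[THEN exE])
  define supp where "supp x = fst (rep x)" for x
  define co where "co x = snd (rep x)" for x
  have supp: "finite (supp x)" "supp x \<subseteq> B" if "x \<in> I" for x
    using rep that by (auto simp: supp_def)
  have co: "co x b \<in> carrier R" if "x \<in> I" for x b
    using rep that by (auto simp: co_def)
  have sum_co: "(\<Oplus>b\<in>G. co x b \<otimes> b) = x"
    if x: "x \<in> I" and G: "finite G" "supp x \<subseteq> G" "G \<subseteq> B" for x G
  proof -
    have "(\<Oplus>b\<in>supp x. co x b \<otimes> b) = (\<Oplus>b\<in>G. co x b \<otimes> b)"
      by (rule add.finprod_mono_neutral_cong_left)
        (use rep x G Bc in \<open>auto simp: supp_def co_def subset_iff\<close>)
    then show ?thesis using rep x by (simp add: supp_def co_def)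
  qed
  define h where "h = (\<lambda>x\<in>I. \<Oplus>\<^bsub>M\<^esub>b\<in>supp x. co x b \<odot>\<^bsub>M\<^esub> n b)"
  have h: "h x = (\<Oplus>\<^bsub>M\<^esub>b\<in>G. co x b \<odot>\<^bsub>M\<^esub> n b)"
    if x: "x \<in> I" and G: "finite G" "supp x \<subseteq> G" "G \<subseteq> B" for x G
  proof -
    have "(\<Oplus>\<^bsub>M\<^esub>b\<in>supp x. co x b \<odot>\<^bsub>M\<^esub> n b) = (\<Oplus>\<^bsub>M\<^esub>b\<in>G. co x b \<odot>\<^bsub>M\<^esub> n b)"
    proof (rule M.add.finprod_mono_neutral_cong_left)
      fix b assume "b \<in> G - supp x"
      then have "co x b = \<zero>" "b \<in> B" using rep x G by (auto simp: supp_def co_def)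
      then show "co x b \<odot>\<^bsub>M\<^esub> n b = \<zero>\<^bsub>M\<^esub>" using nc M.smult_left_zero by simp
    qed (use G x co nc in \<open>auto intro!: M.smult_closed\<close>)
    then show ?thesis using x by (simp add: h_def)
  qed
  have h_closed: "h x \<in> carrier M" if "x \<in> I" for x
    using that supp[OF that] co nc
    by (auto simp: h_def intro!: M.finsum_closed M.smult_closed)
  have cn: "co x b \<odot>\<^bsub>M\<^esub> n b \<in> carrier M" if "x \<in> I" "b \<in> B" for x b
    using that co nc by (simp add: M.smult_closed)
  have h_add: "h (x \<oplus> y) = h x \<oplus>\<^bsub>M\<^esub> h y" if x: "x \<in> I" and y: "y \<in> I" for x y
  proof -
    have xy: "x \<oplus> y \<in> I" using x y Icl by blast
    obtain G where G: "finite G" "G \<subseteq> B"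
      and sx: "supp x \<subseteq> G" and sy: "supp y \<subseteq> G" and sxy: "supp (x \<oplus> y) \<subseteq> G"
      using that[of "supp x \<union> supp y \<union> supp (x \<oplus> y)"] supp x y xy by auto
    have Gc: "G \<subseteq> carrier R" using G Bc by blast
    \<comment> \<open>The chosen coefficients need not be additive. Their sums and the coefficients
      chosen for \<open>x \<oplus> y\<close> represent the same element over \<open>G\<close>, and
      \<open>well_defined\<close> allows one to replace the other.\<close>
    have "(\<Oplus>b\<in>G. (co x b \<oplus> co y b) \<otimes> b) = (\<Oplus>b\<in>G. co x b \<otimes> b \<oplus> co y b \<otimes> b)"
      by (rule finsum_cong') (use Gc co x y in \<open>auto simp: l_distr subset_iff\<close>)
    also have "\<dots> = (\<Oplus>b\<in>G. co x b \<otimes> b) \<oplus> (\<Oplus>b\<in>G. co y b \<otimes> b)"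
      by (rule finsum_addf) (use Gc co x y in \<open>auto simp: subset_iff\<close>)
    also have "\<dots> = x \<oplus> y"
      unfolding sum_co[OF x G(1) sx G(2)] sum_co[OF y G(1) sy G(2)] ..
    also have "\<dots> = (\<Oplus>b\<in>G. co (x \<oplus> y) b \<otimes> b)"
      by (rule sum_co[OF xy G(1) sxy G(2), symmetric])
    finally have "(\<Oplus>\<^bsub>M\<^esub>b\<in>G. co (x \<oplus> y) b \<odot>\<^bsub>M\<^esub> n b) =
        (\<Oplus>\<^bsub>M\<^esub>b\<in>G. (co x b \<oplus> co y b) \<odot>\<^bsub>M\<^esub> n b)"
      using co x y xy by (intro well_defined[symmetric] G) auto
    also have "\<dots> = (\<Oplus>\<^bsub>M\<^esub>b\<in>G. co x b \<odot>\<^bsub>M\<^esub> n b \<oplus>\<^bsub>M\<^esub> co y b \<odot>\<^bsub>M\<^esub> n b)"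
      by (rule M.finsum_cong') (use G(2) nc cn co x y in \<open>auto simp: M.smult_l_distr subset_iff\<close>)
    also have "\<dots> = (\<Oplus>\<^bsub>M\<^esub>b\<in>G. co x b \<odot>\<^bsub>M\<^esub> n b) \<oplus>\<^bsub>M\<^esub> (\<Oplus>\<^bsub>M\<^esub>b\<in>G. co y b \<odot>\<^bsub>M\<^esub> n b)"
      by (rule M.finsum_addf) (use G(2) cn x y in \<open>auto simp: subset_iff\<close>)
    finally show ?thesis
      using h[OF xy G(1) sxy G(2)] h[OF x G(1) sx G(2)] h[OF y G(1) sy G(2)] by simp
  qed
  have h_mult: "h (a \<otimes> x) = a \<odot>\<^bsub>M\<^esub> h x" if a: "a \<in> carrier R" and x: "x \<in> I" for a x
  proof -
    have ax: "a \<otimes> x \<in> I" using a x Icl by blast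
    obtain G where G: "finite G" "G \<subseteq> B" and sx: "supp x \<subseteq> G" and sax: "supp (a \<otimes> x) \<subseteq> G"
      using that[of "supp x \<union> supp (a \<otimes> x)"] supp x ax by auto
    have Gc: "G \<subseteq> carrier R" using G Bc by blast
    have "(\<Oplus>b\<in>G. (a \<otimes> co x b) \<otimes> b) = (\<Oplus>b\<in>G. a \<otimes> (co x b \<otimes> b))"
      by (rule finsum_cong') (use Gc co x a in \<open>auto simp: m_assoc subset_iff\<close>)
    also have "\<dots> = a \<otimes> (\<Oplus>b\<in>G. co x b \<otimes> b)"
      by (rule finsum_rdistr[symmetric]) (use G(1) Gc co x a in \<open>auto simp: subset_iff\<close>)
    also have "\<dots> = a \<otimes> x" unfolding sum_co[OF x G(1) sx G(2)] ..
    also have "\<dots> = (\<Oplus>b\<in>G. co (a \<otimes> x) b \<otimes> b)"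
      by (rule sum_co[OF ax G(1) sax G(2), symmetric])
    finally have "(\<Oplus>\<^bsub>M\<^esub>b\<in>G. co (a \<otimes> x) b \<odot>\<^bsub>M\<^esub> n b) =
        (\<Oplus>\<^bsub>M\<^esub>b\<in>G. (a \<otimes> co x b) \<odot>\<^bsub>M\<^esub> n b)"
      using co x ax a by (intro well_defined[symmetric] G) auto
    also have "\<dots> = (\<Oplus>\<^bsub>M\<^esub>b\<in>G. a \<odot>\<^bsub>M\<^esub> (co x b \<odot>\<^bsub>M\<^esub> n b))"
      by (rule M.finsum_cong')
        (use G(2) nc cn co x a in \<open>auto simp: M.smult_assoc M.smult_closed subset_iff\<close>)
    also have "\<dots> = a \<odot>\<^bsub>M\<^esub> (\<Oplus>\<^bsub>M\<^esub>b\<in>G. co x b \<odot>\<^bsub>M\<^esub> n b)"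
      by (rule M.smult_finsum[symmetric]) (use G cn x a in \<open>auto simp: subset_iff\<close>)
    finally show ?thesis
      using h[OF ax G(1) sax G(2)] h[OF x G(1) sx G(2)] by simp
  qed
  have f_sum: "f (\<Oplus>b\<in>F. s b \<otimes> b) = (\<Oplus>\<^bsub>N\<^esub>b\<in>F. s b \<odot>\<^bsub>N\<^esub> f b) \<and> (\<Oplus>b\<in>F. s b \<otimes> b) \<in> I"
    if "finite F" "F \<subseteq> B" "\<And>b. s b \<in> carrier R" for F s
    using that
  proof (induction F)
    case empty
    then show ?case by (simp add: f_zero Icl)
  next
    case (insert b F)
    have b: "b \<in> I" "F \<subseteq> I" using insert B by auto
    have "(\<Oplus>b\<in>insert b F. s b \<otimes> b) = s b \<otimes> b \<oplus> (\<Oplus>b\<in>F. s b \<otimes> b)"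
      using insert b Icl(1) by (intro finsum_insert) auto
    moreover have "(\<Oplus>\<^bsub>N\<^esub>b\<in>insert b F. s b \<odot>\<^bsub>N\<^esub> f b) = s b \<odot>\<^bsub>N\<^esub> f b \<oplus>\<^bsub>N\<^esub> (\<Oplus>\<^bsub>N\<^esub>b\<in>F. s b \<odot>\<^bsub>N\<^esub> f b)"
      using insert b f_closed by (intro N.finsum_insert) (auto intro!: N.smult_closed)
    ultimately show ?case
      using insert b by (auto simp: f_add f_mult Icl)
  qed
  have h_ext: "h \<in> extensional I" by (simp add: h_def)
  have gh: "g (h x) = f x" if x: "x \<in> I" for x
  proof -
    have "g (h x) = (\<Oplus>\<^bsub>N\<^esub>b\<in>supp x. g (co x b \<odot>\<^bsub>M\<^esub> n b))"
      using mod_hom_finsum[OF M.abelian_group_axioms N.abelian_group_axioms g(1) supp(1)[OF x],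
          of "\<lambda>b. co x b \<odot>\<^bsub>M\<^esub> n b"] supp[OF x] co[OF x] nc x
      by (auto simp: h_def intro!: M.smult_closed)
    also have "\<dots> = (\<Oplus>\<^bsub>N\<^esub>b\<in>supp x. co x b \<odot>\<^bsub>N\<^esub> f b)"
    proof (rule N.finsum_cong')
      fix b assume "b \<in> supp x"
      then have "b \<in> B" using supp x by blast
      then show "g (co x b \<odot>\<^bsub>M\<^esub> n b) = co x b \<odot>\<^bsub>N\<^esub> f b" using g_mult co x nc gn by simp
    qed (use supp(2)[OF x] B co[OF x] f_closed in \<open>auto intro!: N.smult_closed\<close>)
    also have "\<dots> = f x"
      using f_sum[OF supp[OF x], of "co x"] co[OF x] sum_co[OF x supp(1)[OF x] subset_refl supp(2)[OF x]]
      by simp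
    finally show ?thesis .
  qed
  show "\<exists>h\<in>mod_hom R (left_ideal_module R I) M. \<forall>x\<in>carrier (left_ideal_module R I). g (h x) = f x"
  proof (rule bexI[of _ h])
    show "h \<in> mod_hom R (left_ideal_module R I) M"
      using h_closed h_add h_mult h_ext by (simp add: mod_hom_def left_ideal_module_def PiE_iff)
    show "\<forall>x\<in>carrier (left_ideal_module R I). g (h x) = f x"
      using gh by (simp add: left_ideal_module_def)
  qed
qed

end

section \<open>Generation and independence modulo the radical\<close>

context split_minimal_ring
begin

lemma jac_independent_generates_modulo:
  assumes I: "left_ideal I R" and B: "jac_independent I B"
    and max: "\<And>B'. \<lbrakk>jac_independent I B'; B \<subseteq> B'\<rbrakk> \<Longrightarrow> B' = B"
    and x: "x \<in> I"
  shows "\<exists>w\<in>lspan (carrier R) B. \<exists>u\<in>lspan jac I. x = w \<oplus> u"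
proof -
  note Icl = left_ideal_facts[OF I]
  have BI: "B \<subseteq> I" using B by (simp add: jac_independent_def)
  have Bc: "B \<subseteq> carrier R" using BI Icl(1) by blast
  let ?L = "lspan (carrier R) B" and ?U = "lspan jac I"
  define W where "W = {w \<oplus> u |w u. w \<in> ?L \<and> u \<in> ?U}"
  have Lc: "?L \<subseteq> carrier R" and Uc: "?U \<subseteq> carrier R"
    using lspan_carrier Bc Icl(1) jac_carrier by auto
  have L_add: "x \<oplus> y \<in> ?L" if "x \<in> ?L" "y \<in> ?L" for x y
    using lspan_add[OF subset_refl Bc that] .
  have U_add: "x \<oplus> y \<in> ?U" if "x \<in> ?U" "y \<in> ?U" for x y
    using lspan_add[OF jac_carrier Icl(1) that] .
  have U_minus: "\<ominus> x \<in> ?U" if "x \<in> ?U" for x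
    by (rule lspan_minus[OF jac_carrier Icl(1) that]) (rule jac_mult)
  have L_minus: "\<ominus> x \<in> ?L" if "x \<in> ?L" for x
    by (rule lspan_minus[OF subset_refl Bc that]) (rule m_closed)
  have Wc: "W \<subseteq> carrier R" using Lc Uc by (auto simp: W_def)
  have W_add: "x \<oplus> y \<in> W" if xy: "x \<in> W" "y \<in> W" for x y
  proof -
    obtain w u w' u' where *: "w \<in> ?L" "u \<in> ?U" "w' \<in> ?L" "u' \<in> ?U" "x = w \<oplus> u" "y = w' \<oplus> u'"
      using xy unfolding W_def by blast
    then have "x \<oplus> y = (w \<oplus> w') \<oplus> (u \<oplus> u')" using Lc Uc by (auto simp: a_ac subset_iff)
    then show ?thesis using * L_add U_add unfolding W_def by blast
  qed
  have W_mult: "s \<otimes> x \<in> W" if sx: "s \<in> carrier R" "x \<in> W" for s x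
  proof -
    obtain w u where *: "w \<in> ?L" "u \<in> ?U" "x = w \<oplus> u" using sx(2) unfolding W_def by blast
    then have "s \<otimes> x = s \<otimes> w \<oplus> s \<otimes> u" using sx(1) Lc Uc by (auto simp: r_distr subset_iff)
    moreover have "s \<otimes> w \<in> ?L" 
      by (rule lspan_mult[OF subset_refl Bc sx(1) *(1)]) (rule m_closed[OF sx(1)])
    moreover have "s \<otimes> u \<in> ?U" 
      by (rule lspan_mult[OF jac_carrier Icl(1) sx(1) *(2)]) (rule jac_mult[OF sx(1)])
    ultimately show ?thesis unfolding W_def by blast
  qed
  have "x \<in> W"
  proof (rule ccontr)
    assume "x \<notin> W"
    then have "I - W \<noteq> {}" using x by blast
    moreover have "I - W \<subseteq> carrier R" using Icl(1) by blast
    ultimately obtain b where b: "b \<in> I - W"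
      and min: "\<forall>s\<in>carrier R. s \<otimes> b \<in> I - W \<longrightarrow> (\<exists>t\<in>carrier R. b = t \<otimes> (s \<otimes> b))"
      using minimal_principal by meson
    have bc: "b \<in> carrier R" using b Icl(1) by blast
    have small: "\<exists>j\<in>jac. s \<otimes> b = j \<otimes> b" if s: "s \<in> carrier R" "s \<otimes> b \<in> W" for s
      by (rule minimal_generator_jac[OF bc _ Wc W_add W_mult _ s])
        (use b min Icl(4) in auto)
    have "jac_independent I (insert b B)"
      unfolding jac_independent_def
    proof (intro conjI allI impI)
      show "insert b B \<subseteq> I" using b BI by blast
      fix F s assume F: "finite F" "F \<subseteq> insert b B" "s \<in> F \<rightarrow> carrier R"
        and sum: "(\<Oplus>b\<in>F. s b \<otimes> b) \<in> ?U"
      show "\<forall>c\<in>F. \<exists>j\<in>jac. s c \<otimes> c = j \<otimes> c"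
      proof (cases "b \<in> F")
        case False
        then have "F \<subseteq> B" using F by blast
        then show ?thesis using B F sum unfolding jac_independent_def by blast
      next
        case True
        let ?F = "F - {b}"
        have F': "finite ?F" "?F \<subseteq> B" "s \<in> ?F \<rightarrow> carrier R" using F by auto
        have F'c: "?F \<subseteq> carrier R" using F' Bc by blast
        have sb: "s b \<in> carrier R" using F(3) True by blast
        let ?x = "\<Oplus>c\<in>?F. s c \<otimes> c"
        have xL: "?x \<in> ?L" using lspan_finsum[OF subset_refl Bc F'] .
        then have xc: "?x \<in> carrier R" using Lc by blast
        have "(\<Oplus>c\<in>insert b ?F. s c \<otimes> c) = s b \<otimes> b \<oplus> ?x"
          by (rule finsum_insert) (use F' sb bc F'c in \<open>auto simp: Pi_iff subset_iff\<close>)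
        then have split_sum: "s b \<otimes> b \<oplus> ?x \<in> ?U" using sum True by (simp add: insert_absorb)
        have "s b \<otimes> b = \<ominus> ?x \<oplus> (s b \<otimes> b \<oplus> ?x)"
          using xc sb bc by (simp add: a_ac r_neg r_neg1 r_neg2)
        then have "s b \<otimes> b \<in> W" using L_minus[OF xL] split_sum unfolding W_def by blast
        then obtain j where j: "j \<in> jac" "s b \<otimes> b = j \<otimes> b" using small[OF sb] by blast
        have "j \<otimes> b \<in> ?U" using lspan_base[OF jac_carrier Icl(1) j(1)] b by blast
        then have "\<ominus> (s b \<otimes> b) \<oplus> (s b \<otimes> b \<oplus> ?x) \<in> ?U" using U_add U_minus split_sum j by simp
        then have "?x \<in> ?U" using xc sb bc by (simp add: r_neg1)
        then have "\<forall>c\<in>?F. \<exists>j\<in>jac. s c \<otimes> c = j \<otimes> c"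
          using B F' unfolding jac_independent_def by blast
        then show ?thesis using j by blast
      qed
    qed
    then have "insert b B = B" by (rule max) blast
    then have "\<one> \<otimes> b \<in> ?L" using lspan_base[OF subset_refl Bc one_closed] by blast
    then have "\<one> \<otimes> b \<oplus> \<zero> \<in> W" unfolding W_def using lspan.zero by blast
    then show False using b bc by simp
  qed
  then show ?thesis unfolding W_def by blast
qed

text \<open>Nakayama's argument with a nilpotent radical, by downward induction on \<open>n\<close>:
  products of \<open>n\<close> radical elements carry \<open>I\<close> into the span of
  \<open>B\<close>. Splitting \<open>x\<close> modulo J I leaves a remainder on which such a product
  acts with one more radical factor.\<close>

lemma jac_independent_generates:
  assumes I: "left_ideal I R" and B: "jac_independent I B"
    and max: "\<And>B'. \<lbrakk>jac_independent I B'; B \<subseteq> B'\<rbrakk> \<Longrightarrow> B' = B"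
  shows "I \<subseteq> lspan (carrier R) B"
proof -
  note Icl = left_ideal_facts[OF I]
  have Bc: "B \<subseteq> carrier R" using B Icl(1) by (auto simp: jac_independent_def)
  let ?L = "lspan (carrier R) B"
  have Lc: "?L \<subseteq> carrier R" using lspan_carrier[OF subset_refl Bc] .
  obtain N where N: "jac_prods N \<subseteq> {\<zero>}" using jac_nilpotent by blast
  have "\<forall>q\<in>jac_prods n. \<forall>x\<in>I. q \<otimes> x \<in> ?L" if "n \<le> N" for n
    using that
  proof (induction n rule: inc_induct)
    case base
    show ?case
    proof (intro ballI)
      fix q x assume "q \<in> jac_prods N" "x \<in> I"
      then have "q = \<zero>" "x \<in> carrier R" using N Icl(1) by auto
      then have "q \<otimes> x = \<zero>" by simp
      then show "q \<otimes> x \<in> ?L" by (simp add: lspan.zero)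
    qed
  next
    case (step n)
    show ?case
    proof (intro ballI)
      fix q x assume q: "q \<in> jac_prods n" and x: "x \<in> I"
      have qc: "q \<in> carrier R" using q jac_prods_carrier by blast
      obtain w u where wu: "w \<in> ?L" "u \<in> lspan jac I" "x = w \<oplus> u"
        using jac_independent_generates_modulo[OF I B max x] by blast
      have "q \<otimes> u \<in> ?L"
        using wu(2)
      proof induction
        case zero
        then show ?case using qc by (simp add: lspan.zero)
      next
        case (add v j y)
        have "v \<in> carrier R" "j \<in> carrier R" "y \<in> carrier R"
          using add lspan_carrier[OF jac_carrier Icl(1)] jac_carrier Icl(1) by auto
        then have "q \<otimes> (v \<oplus> j \<otimes> y) = q \<otimes> v \<oplus> (q \<otimes> j) \<otimes> y"
          using qc by (simp add: r_distr m_assoc)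
        moreover have "(q \<otimes> j) \<otimes> y \<in> ?L"
          using step.IH jac_prods_Suc_right[OF q add(2)] add(3) by blast
        ultimately show ?case using lspan_add[OF subset_refl Bc] add.IH by simp
      qed
      moreover have "q \<otimes> w \<in> ?L" 
        by (rule lspan_mult[OF subset_refl Bc qc wu(1)]) (rule m_closed[OF qc])
      moreover have "q \<otimes> x = q \<otimes> w \<oplus> q \<otimes> u"
        using wu qc Lc lspan_carrier[OF jac_carrier Icl(1)] by (auto simp: r_distr subset_iff)
      ultimately show "q \<otimes> x \<in> ?L" using lspan_add[OF subset_refl Bc] by simp
    qed
  qed
  from this[of 0] have *: "\<forall>x\<in>I. \<one> \<otimes> x \<in> ?L" by simp
  show ?thesis
  proof
    fix x assume x: "x \<in> I"
    then have "\<one> \<otimes> x = x" using Icl(1) by auto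
    then show "x \<in> ?L" using bspec[OF * x] by simp
  qed
qed

text \<open>Independence only places the terms of a relation in J b. The section
  \<open>\<epsilon>\<close> gives more: a relation is killed by \<open>\<epsilon>\<close>, so its
  coefficients are reproduced by the identity matrix minus \<open>\<epsilon>\<close>, and the
  entries of that matrix may be replaced by radical elements without changing their products with
  the generators. Iterating this exhausts the radical.\<close>

lemma jac_independent_zero:
  assumes I: "left_ideal I R" and B: "jac_independent I B"
    and F: "finite F" "F \<subseteq> B" and s: "s \<in> F \<rightarrow> carrier R" "(\<Oplus>b\<in>F. s b \<otimes> b) = \<zero>" and b: "b \<in> F"
  shows "s b \<otimes> b = \<zero>"
proof -
  note Icl = left_ideal_facts[OF I]
  have Fc: "F \<subseteq> carrier R" using F B Icl(1) by (auto simp: jac_independent_def)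
  obtain \<epsilon> where \<epsilon>: "\<epsilon> \<in> F \<rightarrow> F \<rightarrow> carrier R" "\<forall>c\<in>F. (\<Oplus>b\<in>F. \<epsilon> c b \<otimes> b) = c"
    and ker: "\<forall>s\<in>F \<rightarrow> carrier R. (\<Oplus>b\<in>F. s b \<otimes> b) = \<zero> \<longrightarrow> (\<forall>b\<in>F. (\<Oplus>c\<in>F. s c \<otimes> \<epsilon> c b) = \<zero>)"
    using split[OF F(1) Fc] by blast
  define \<delta> where "\<delta> c b = (if b = c then \<one> else \<zero>)" for b c :: 'a
  have \<epsilon>c: "\<epsilon> c b \<in> carrier R" if "c \<in> F" "b \<in> F" for c b using \<epsilon>(1) that by auto
  \<comment> \<open>Row \<open>c\<close> of the identity matrix minus \<open>\<epsilon>\<close> is a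
    relation, since both matrices send the generators to \<open>c\<close>. Independence applies to
    each of its terms.\<close>
  have exj: "\<exists>j\<in>jac. (\<delta> c b \<ominus> \<epsilon> c b) \<otimes> b = j \<otimes> b" if c: "c \<in> F" and b: "b \<in> F" for c b
  proof -
    have "(\<Oplus>b\<in>F. (\<delta> c b \<ominus> \<epsilon> c b) \<otimes> b) \<oplus> (\<Oplus>b\<in>F. \<epsilon> c b \<otimes> b) =
        (\<Oplus>b\<in>F. (\<delta> c b \<ominus> \<epsilon> c b) \<otimes> b \<oplus> \<epsilon> c b \<otimes> b)"
      by (rule finsum_addf[symmetric]) (use Fc \<epsilon>c c in \<open>auto simp: \<delta>_def\<close>)
    also have "\<dots> = (\<Oplus>b\<in>F. if c = b then c else \<zero>)"
    proof (rule finsum_cong')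
      fix b assume b: "b \<in> F"
      then have "b \<in> carrier R" using Fc by blast
      then show "(\<delta> c b \<ominus> \<epsilon> c b) \<otimes> b \<oplus> \<epsilon> c b \<otimes> b = (if c = b then c else \<zero>)"
        using \<epsilon>c[OF c b] by (auto simp: \<delta>_def minus_eq l_distr l_minus a_assoc l_neg)
    qed (use Fc c in auto)
    also have "\<dots> = c"
      using add.finprod_singleton[OF c F(1), of "\<lambda>_. c"] c Fc by auto
    finally have *: "(\<Oplus>b\<in>F. (\<delta> c b \<ominus> \<epsilon> c b) \<otimes> b) \<oplus> c = c" using \<epsilon>(2) c by simp
    have "(\<Oplus>b\<in>F. (\<delta> c b \<ominus> \<epsilon> c b) \<otimes> b) \<in> carrier R"
      by (rule finsum_closed) (use Fc \<epsilon>c c in \<open>auto simp: \<delta>_def\<close>)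
    then have "(\<Oplus>b\<in>F. (\<delta> c b \<ominus> \<epsilon> c b) \<otimes> b) = \<zero>" using * c Fc by auto
    then have "(\<Oplus>b\<in>F. (\<delta> c b \<ominus> \<epsilon> c b) \<otimes> b) \<in> lspan jac I" by (simp add: lspan.zero)
    moreover have "(\<lambda>b. \<delta> c b \<ominus> \<epsilon> c b) \<in> F \<rightarrow> carrier R" using \<epsilon>c c by (auto simp: \<delta>_def)
    ultimately show ?thesis using B F b unfolding jac_independent_def by blast
  qed
  define u where "u c b = (SOME j. j \<in> jac \<and> (\<delta> c b \<ominus> \<epsilon> c b) \<otimes> b = j \<otimes> b)" for c b
  have u: "u c b \<in> jac" "(\<delta> c b \<ominus> \<epsilon> c b) \<otimes> b = u c b \<otimes> b" if "c \<in> F" "b \<in> F" for c b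
    using someI_ex[OF exj[OF that, unfolded Bex_def]] unfolding u_def by blast+
  have uc: "u c b \<in> carrier R" if "c \<in> F" "b \<in> F" for c b using u(1)[OF that] jac_carrier by blast
  obtain N where N: "jac_prods N \<subseteq> {\<zero>}" using jac_nilpotent by blast
  \<comment> \<open>Having extracted N - n radical factors is recorded by what it achieves: the
    coefficients kill all products of length \<open>n\<close>. This is trivial at
    \<open>n = N\<close>, and at \<open>n = 0\<close> the coefficients vanish.\<close>
  have "\<exists>t\<in>F \<rightarrow> carrier R. (\<forall>b\<in>F. t b \<otimes> b = s b \<otimes> b) \<and> (\<forall>b\<in>F. \<forall>q\<in>jac_prods n. t b \<otimes> q = \<zero>)"
    if "n \<le> N" for n
    using that
  proof (induction n rule: inc_induct)
    case base
    have "s b \<otimes> q = \<zero>" if "b \<in> F" "q \<in> jac_prods N" for b q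
    proof -
      have "q = \<zero>" "s b \<in> carrier R" using N s that by auto
      then show ?thesis by simp
    qed
    then show ?case using s by blast
  next
    case (step n)
    then obtain t where t: "t \<in> F \<rightarrow> carrier R" "\<forall>b\<in>F. t b \<otimes> b = s b \<otimes> b"
      "\<forall>b\<in>F. \<forall>q\<in>jac_prods (Suc n). t b \<otimes> q = \<zero>" by blast
    have tc: "t c \<in> carrier R" if "c \<in> F" for c using t(1) that by blast
    have "(\<Oplus>b\<in>F. t b \<otimes> b) = (\<Oplus>b\<in>F. s b \<otimes> b)"
      by (rule finsum_cong') (use t s Fc in auto)
    then have t0: "\<forall>b\<in>F. (\<Oplus>c\<in>F. t c \<otimes> \<epsilon> c b) = \<zero>" using ker t(1) s(2) by simp
    \<comment> \<open>By \<open>t0\<close>, \<open>t\<close> equals its product with the identity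
      matrix minus \<open>\<epsilon>\<close>. Replacing the entries of that matrix by
      \<open>u\<close> alters the coefficients but not the terms
      \<open>t b \<otimes> b\<close>.\<close>
    define t' where "t' b = (\<Oplus>c\<in>F. t c \<otimes> u c b)" for b
    have t'c: "t' b \<in> carrier R" if "b \<in> F" for b
      unfolding t'_def by (rule finsum_closed) (use that tc uc in auto)
    have "t' b \<otimes> b = t b \<otimes> b" if b: "b \<in> F" for b
    proof -
      have bc: "b \<in> carrier R" using b Fc by blast
      have "t' b \<otimes> b = (\<Oplus>c\<in>F. (t c \<otimes> u c b) \<otimes> b)"
        unfolding t'_def by (rule finsum_ldistr[OF F(1) bc]) (use b tc uc in auto)
      also have "\<dots> = (\<Oplus>c\<in>F. (t c \<otimes> (\<delta> c b \<ominus> \<epsilon> c b)) \<otimes> b)"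
      proof (rule finsum_cong')
        fix c assume c: "c \<in> F"
        have "\<delta> c b \<ominus> \<epsilon> c b \<in> carrier R" using \<epsilon>c[OF c b] by (simp add: \<delta>_def)
        then show "(t c \<otimes> u c b) \<otimes> b = (t c \<otimes> (\<delta> c b \<ominus> \<epsilon> c b)) \<otimes> b"
          using u(2)[OF c b] tc[OF c] uc[OF c b] bc by (simp add: m_assoc)
      qed (use b bc tc \<epsilon>c in \<open>auto simp: \<delta>_def\<close>)
      also have "\<dots> = (\<Oplus>c\<in>F. t c \<otimes> (\<delta> c b \<ominus> \<epsilon> c b)) \<otimes> b"
        by (rule finsum_ldistr[OF F(1) bc, symmetric]) (use b tc \<epsilon>c in \<open>auto simp: \<delta>_def\<close>)
      also have "(\<Oplus>c\<in>F. t c \<otimes> (\<delta> c b \<ominus> \<epsilon> c b)) = t b"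
      proof -
        have cl: "(\<Oplus>c\<in>F. t c \<otimes> (\<delta> c b \<ominus> \<epsilon> c b)) \<in> carrier R"
          by (rule finsum_closed) (use b tc \<epsilon>c in \<open>auto simp: \<delta>_def\<close>)
        have "(\<Oplus>c\<in>F. t c \<otimes> (\<delta> c b \<ominus> \<epsilon> c b)) \<oplus> (\<Oplus>c\<in>F. t c \<otimes> \<epsilon> c b) =
            (\<Oplus>c\<in>F. t c \<otimes> (\<delta> c b \<ominus> \<epsilon> c b) \<oplus> t c \<otimes> \<epsilon> c b)"
          by (rule finsum_addf[symmetric]) (use b tc \<epsilon>c in \<open>auto simp: \<delta>_def\<close>)
        also have "\<dots> = (\<Oplus>c\<in>F. if b = c then t c else \<zero>)"
        proof (rule finsum_cong')
          fix c assume c: "c \<in> F"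
          show "t c \<otimes> (\<delta> c b \<ominus> \<epsilon> c b) \<oplus> t c \<otimes> \<epsilon> c b = (if b = c then t c else \<zero>)"
            using tc[OF c] \<epsilon>c[OF c b] by (auto simp: \<delta>_def minus_eq r_distr r_minus a_assoc l_neg)
        qed (use tc in auto)
        also have "\<dots> = t b" by (rule add.finprod_singleton[OF b F(1) t(1)])
        finally show ?thesis using cl t0 b by simp
      qed
      finally show ?thesis .
    qed
    moreover have "t' b \<otimes> q = \<zero>" if b: "b \<in> F" and q: "q \<in> jac_prods n" for b q
    proof -
      have qc: "q \<in> carrier R" using q jac_prods_carrier by blast
      have "t' b \<otimes> q = (\<Oplus>c\<in>F. (t c \<otimes> u c b) \<otimes> q)"
        unfolding t'_def by (rule finsum_ldistr[OF F(1) qc]) (use b tc uc in auto)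
      also have "\<dots> = (\<Oplus>c\<in>F. \<zero>)"
      proof (rule finsum_cong')
        fix c assume c: "c \<in> F"
        have "u c b \<otimes> q \<in> jac_prods (Suc n)" using u(1)[OF c b] q by auto
        then show "(t c \<otimes> u c b) \<otimes> q = \<zero>"
          using t(3) c tc[OF c] uc[OF c b] qc by (simp add: m_assoc)
      qed auto
      finally show ?thesis by simp
    qed
    ultimately show ?case using t(2) t'c by (intro bexI[of _ t']) auto
  qed
  from this[of 0] obtain t where t: "t \<in> F \<rightarrow> carrier R" "\<forall>b\<in>F. t b \<otimes> b = s b \<otimes> b"
    "\<forall>b\<in>F. t b \<otimes> \<one> = \<zero>"
    by auto
  have "t b \<in> carrier R" "b \<in> carrier R" using t(1) b Fc by auto
  moreover from this have "t b = \<zero>" using bspec[OF t(3) b] by simp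
  ultimately show ?thesis using bspec[OF t(2) b] by simp
qed

theorem left_hereditary: "left_hereditary TYPE('m) TYPE('n) R"
  unfolding left_hereditary_def
proof (intro conjI allI impI ring_axioms)
  fix I assume I: "left_ideal I R"
  note Icl = left_ideal_facts[OF I]
  obtain B where B: "jac_independent I B"
    and max: "\<And>B'. \<lbrakk>jac_independent I B'; B \<subseteq> B'\<rbrakk> \<Longrightarrow> B' = B"
    using jac_independent_maximal[of I] by blast
  have BI: "B \<subseteq> I" using B by (simp add: jac_independent_def)
  show "projective TYPE('m) TYPE('n) R (left_ideal_module R I)"
  proof (rule projective_of_independent[OF I BI])
    show "I \<subseteq> lspan (carrier R) B" by (rule jac_independent_generates[OF I B max])
    show "\<And>F s b. \<lbrakk>finite F; F \<subseteq> B; s \<in> F \<rightarrow> carrier R; (\<Oplus>b\<in>F. s b \<otimes> b) = \<zero>; b \<in> F\<rbrakk> \<Longrightarrow>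
        s b \<otimes> b = \<zero>"
      by (rule jac_independent_zero[OF I B])
    fix b assume "b \<in> B"
    then have "b \<in> carrier R" using BI Icl(1) by blast
    then obtain e where "e \<in> carrier R" "e \<otimes> b = b"
      "\<And>s. \<lbrakk>s \<in> carrier R; s \<otimes> b = \<zero>\<rbrakk> \<Longrightarrow> s \<otimes> e = \<zero>"
      by (rule split_single) blast
    then show "\<exists>e\<in>carrier R. e \<otimes> b = b \<and> (\<forall>s\<in>carrier R. s \<otimes> b = \<zero> \<longrightarrow> s \<otimes> e = \<zero>)"
      by blast
  qed
qed

end

section \<open>Projections and direct powers\<close>

lemma mod_hom_closed: "\<lbrakk>f \<in> mod_hom R M N; x \<in> carrier M\<rbrakk> \<Longrightarrow> f x \<in> carrier N"
  by (auto simp: mod_hom_def)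

lemma mod_hom_add:
  "\<lbrakk>f \<in> mod_hom R M N; x \<in> carrier M; y \<in> carrier M\<rbrakk> \<Longrightarrow> f (x \<oplus>\<^bsub>M\<^esub> y) = f x \<oplus>\<^bsub>N\<^esub> f y"
  by (auto simp: mod_hom_def)

lemma mod_hom_smult:
  "\<lbrakk>f \<in> mod_hom R M N; a \<in> carrier R; x \<in> carrier M\<rbrakk> \<Longrightarrow> f (a \<odot>\<^bsub>M\<^esub> x) = a \<odot>\<^bsub>N\<^esub> f x"
  by (auto simp: mod_hom_def)

lemma mod_hom_zero:
  assumes "abelian_group M" "abelian_group N" "f \<in> mod_hom R M N"
  shows "f \<zero>\<^bsub>M\<^esub> = \<zero>\<^bsub>N\<^esub>"
  using mod_hom_finsum[OF assms, of "{}" undefined] assms(1,2)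
  by (simp add: abelian_monoid.finsum_empty abelian_group.axioms(1))

lemma mod_hom_restrictI:
  assumes "\<And>x. x \<in> carrier M \<Longrightarrow> f x \<in> carrier N"
    and "\<And>x y. \<lbrakk>x \<in> carrier M; y \<in> carrier M\<rbrakk> \<Longrightarrow> f (x \<oplus>\<^bsub>M\<^esub> y) = f x \<oplus>\<^bsub>N\<^esub> f y"
    and "\<And>a x. \<lbrakk>a \<in> carrier R; x \<in> carrier M\<rbrakk> \<Longrightarrow> f (a \<odot>\<^bsub>M\<^esub> x) = a \<odot>\<^bsub>N\<^esub> f x"
    and "right_module R M"
  shows "(\<lambda>x\<in>carrier M. f x) \<in> mod_hom R M N"
proof -
  interpret M: right_module R M by fact
  show ?thesis using assms(1-3) by (auto simp: mod_hom_def M.smult_closed)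
qed

lemma mod_hom_comp:
  assumes "f \<in> mod_hom R M N" "g \<in> mod_hom R N P" "right_module R M"
  shows "(\<lambda>x\<in>carrier M. g (f x)) \<in> mod_hom R M P"
  by (rule mod_hom_restrictI)
    (use assms in \<open>auto simp: mod_hom_closed mod_hom_add mod_hom_smult\<close>)

lemma (in right_module) submodule_facts:
  assumes "submodule N R M"
  shows "N \<subseteq> carrier M" "\<zero>\<^bsub>M\<^esub> \<in> N" "\<And>x y. \<lbrakk>x \<in> N; y \<in> N\<rbrakk> \<Longrightarrow> x \<oplus>\<^bsub>M\<^esub> y \<in> N"
    "\<And>x. x \<in> N \<Longrightarrow> \<ominus>\<^bsub>M\<^esub> x \<in> N" "\<And>a x. \<lbrakk>a \<in> carrier R; x \<in> N\<rbrakk> \<Longrightarrow> a \<odot>\<^bsub>M\<^esub> x \<in> N"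
proof -
  interpret N: submodule N R M by fact
  show "N \<subseteq> carrier M" using N.subset by simp
  show "\<zero>\<^bsub>M\<^esub> \<in> N" using N.one_closed by simp
  show "x \<oplus>\<^bsub>M\<^esub> y \<in> N" if "x \<in> N" "y \<in> N" for x y using N.m_closed[OF that] by simp
  show "\<ominus>\<^bsub>M\<^esub> x \<in> N" if "x \<in> N" for x using N.m_inv_closed[OF that] by (simp add: a_inv_def)
  show "a \<odot>\<^bsub>M\<^esub> x \<in> N" if "a \<in> carrier R" "x \<in> N" for a x using N.smult_closed[OF that] .
qed

lemma (in right_module) direct_summand_projection:
  assumes "direct_summand R M N"
  obtains \<pi> where "\<pi> \<in> mod_hom R M M" "\<And>x. x \<in> carrier M \<Longrightarrow> \<pi> x \<in> N" "\<And>x. x \<in> N \<Longrightarrow> \<pi> x = x"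
proof -
  obtain K where N: "submodule N R M" and K: "submodule K R M"
    and int: "N \<inter> K = {\<zero>\<^bsub>M\<^esub>}" and sum: "N <+>\<^bsub>M\<^esub> K = carrier M"
    using assms by (auto simp: direct_summand_def)
  note N = submodule_facts[OF N] and K = submodule_facts[OF K]
  have ex: "\<exists>n\<in>N. \<exists>k\<in>K. x = n \<oplus>\<^bsub>M\<^esub> k" if "x \<in> carrier M" for x
    using that unfolding sum[symmetric] by (auto simp: set_add_def set_mult_def)
  have unique: "n = n'" if "n \<in> N" "n' \<in> N" "k \<in> K" "k' \<in> K" "n \<oplus>\<^bsub>M\<^esub> k = n' \<oplus>\<^bsub>M\<^esub> k'" for n n' k k'
  proof -
    have c: "n \<in> carrier M" "n' \<in> carrier M" "k \<in> carrier M" "k' \<in> carrier M"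
      using that N(1) K(1) by auto
    have "n \<oplus>\<^bsub>M\<^esub> \<ominus>\<^bsub>M\<^esub> n' = (n \<oplus>\<^bsub>M\<^esub> k) \<oplus>\<^bsub>M\<^esub> (\<ominus>\<^bsub>M\<^esub> k \<oplus>\<^bsub>M\<^esub> \<ominus>\<^bsub>M\<^esub> n')"
      using c by (simp add: M.a_assoc M.r_neg2)
    also have "\<dots> = (n' \<oplus>\<^bsub>M\<^esub> k') \<oplus>\<^bsub>M\<^esub> (\<ominus>\<^bsub>M\<^esub> k \<oplus>\<^bsub>M\<^esub> \<ominus>\<^bsub>M\<^esub> n')" using that(5) by simp
    also have "\<dots> = k' \<oplus>\<^bsub>M\<^esub> \<ominus>\<^bsub>M\<^esub> k"
      using c by (simp add: M.a_ac M.r_neg2 M.r_neg1 M.r_neg M.l_neg)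
    finally have "n \<oplus>\<^bsub>M\<^esub> \<ominus>\<^bsub>M\<^esub> n' \<in> N \<inter> K" using that N(3,4) K(3,4) by (metis IntI)
    then have "n \<oplus>\<^bsub>M\<^esub> \<ominus>\<^bsub>M\<^esub> n' = \<zero>\<^bsub>M\<^esub>" using int by simp
    then show ?thesis using c by (metis M.minus_equality M.minus_minus M.a_inv_closed)
  qed
  define p where "p x = (SOME n. n \<in> N \<and> (\<exists>k\<in>K. x = n \<oplus>\<^bsub>M\<^esub> k))" for x
  have p: "p x \<in> N \<and> (\<exists>k\<in>K. x = p x \<oplus>\<^bsub>M\<^esub> k)" if "x \<in> carrier M" for x
    unfolding p_def by (rule someI_ex) (use ex[OF that] in blast)
  have p_eq: "p x = n" if "n \<in> N" "k \<in> K" "x = n \<oplus>\<^bsub>M\<^esub> k" for x n k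
  proof -
    have "x \<in> carrier M" using that N(1) K(1) by auto
    then obtain k' where "k' \<in> K" "x = p x \<oplus>\<^bsub>M\<^esub> k'" "p x \<in> N" using p by blast
    then show ?thesis using unique[of "p x" n k' k] that by simp
  qed
  have p_add: "p (x \<oplus>\<^bsub>M\<^esub> y) = p x \<oplus>\<^bsub>M\<^esub> p y" if xy: "x \<in> carrier M" "y \<in> carrier M" for x y
  proof -
    obtain k l where kl: "k \<in> K" "x = p x \<oplus>\<^bsub>M\<^esub> k" "l \<in> K" "y = p y \<oplus>\<^bsub>M\<^esub> l"
      using p xy by blast
    have c: "p x \<in> carrier M" "p y \<in> carrier M" "k \<in> carrier M" "l \<in> carrier M"
      using p xy kl N(1) K(1) by auto
    have "x \<oplus>\<^bsub>M\<^esub> y = (p x \<oplus>\<^bsub>M\<^esub> k) \<oplus>\<^bsub>M\<^esub> (p y \<oplus>\<^bsub>M\<^esub> l)" using kl by simp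
    also have "\<dots> = (p x \<oplus>\<^bsub>M\<^esub> p y) \<oplus>\<^bsub>M\<^esub> (k \<oplus>\<^bsub>M\<^esub> l)" using c by (simp add: M.a_ac)
    finally show ?thesis using p xy N(3) K(3) kl by (intro p_eq) auto
  qed
  have p_smult: "p (a \<odot>\<^bsub>M\<^esub> x) = a \<odot>\<^bsub>M\<^esub> p x" if ax: "a \<in> carrier R" "x \<in> carrier M" for a x
  proof -
    obtain k where k: "k \<in> K" "x = p x \<oplus>\<^bsub>M\<^esub> k" using p ax by blast
    have c: "p x \<in> carrier M" "k \<in> carrier M" using p ax k N(1) K(1) by auto
    have "a \<odot>\<^bsub>M\<^esub> x = a \<odot>\<^bsub>M\<^esub> (p x \<oplus>\<^bsub>M\<^esub> k)" using k by simp
    also have "\<dots> = a \<odot>\<^bsub>M\<^esub> p x \<oplus>\<^bsub>M\<^esub> a \<odot>\<^bsub>M\<^esub> k" using ax c by (simp add: smult_r_distr)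
    finally show ?thesis using p ax N(5) K(5) k by (intro p_eq) auto
  qed
  show thesis
  proof (rule that[of "\<lambda>x\<in>carrier M. p x"])
    show "(\<lambda>x\<in>carrier M. p x) \<in> mod_hom R M M"
      by (rule mod_hom_restrictI[OF _ p_add p_smult right_module_axioms]) (use p N(1) in auto)
    show "(\<lambda>x\<in>carrier M. p x) x \<in> N" if "x \<in> carrier M" for x using p that by simp
    show "(\<lambda>x\<in>carrier M. p x) x = x" if "x \<in> N" for x
    proof -
      have "x \<in> carrier M" using that N(1) by blast
      then show ?thesis using p_eq[of x "\<zero>\<^bsub>M\<^esub>" x] that K(2) by simp
    qed
  qed
qed

lemma split_injection:
  assumes "right_module R P" "right_module R Q" and \<phi>: "\<phi> \<in> mod_hom R P Q" "inj_on \<phi> (carrier P)"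
    and "direct_summand R Q (\<phi> ` carrier P)"
  obtains \<psi> where "\<psi> \<in> mod_hom R Q P" "\<And>y. y \<in> carrier P \<Longrightarrow> \<psi> (\<phi> y) = y"
proof -
  interpret P: right_module R P by fact
  interpret Q: right_module R Q by fact
  obtain \<pi> where \<pi>: "\<pi> \<in> mod_hom R Q Q" "\<And>x. x \<in> carrier Q \<Longrightarrow> \<pi> x \<in> \<phi> ` carrier P"
    "\<And>x. x \<in> \<phi> ` carrier P \<Longrightarrow> \<pi> x = x"
    using Q.direct_summand_projection[OF assms(5)] by blast
  \<comment> \<open>The retraction projects onto the image of \<open>\<phi>\<close> and then inverts
    \<open>\<phi>\<close> there.\<close>
  define q where "q y = inv_into (carrier P) \<phi> (\<pi> y)" for y
  have q: "q y \<in> carrier P" "\<phi> (q y) = \<pi> y" if "y \<in> carrier Q" for y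
    using \<pi>(2)[OF that] by (simp_all add: q_def inv_into_into f_inv_into_f)
  have eq: "q y = z" if "y \<in> carrier Q" "z \<in> carrier P" "\<phi> z = \<pi> y" for y z
    using inj_onD[OF \<phi>(2), of "q y" z] q[OF that(1)] that by simp
  have "(\<lambda>y\<in>carrier Q. q y) \<in> mod_hom R Q P"
  proof (rule mod_hom_restrictI)
    fix x y assume xy: "x \<in> carrier Q" "y \<in> carrier Q"
    show "q (x \<oplus>\<^bsub>Q\<^esub> y) = q x \<oplus>\<^bsub>P\<^esub> q y"
      by (rule eq) (use xy q \<phi>(1) \<pi>(1) in \<open>simp_all add: mod_hom_add\<close>)
  next
    fix a x assume ax: "a \<in> carrier R" "x \<in> carrier Q"
    show "q (a \<odot>\<^bsub>Q\<^esub> x) = a \<odot>\<^bsub>P\<^esub> q x"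
      by (rule eq) (use ax q \<phi>(1) \<pi>(1) in \<open>simp_all add: mod_hom_smult Q.smult_closed P.smult_closed\<close>)
  qed (use q assms in auto)
  moreover have "(\<lambda>y\<in>carrier Q. q y) (\<phi> y) = y" if "y \<in> carrier P" for y
    using eq[of "\<phi> y" y] \<pi>(3) mod_hom_closed[OF \<phi>(1) that] that by simp
  ultimately show thesis using that by blast
qed

section \<open>Inclusions and components of direct powers\<close>

definition power_incl :: "('r, 'm) module \<Rightarrow> 'i set \<Rightarrow> 'i \<Rightarrow> 'm \<Rightarrow> 'i \<Rightarrow> 'm"
  where "power_incl M \<Lambda> i = (\<lambda>x\<in>carrier M. \<lambda>j\<in>\<Lambda>. if j = i then x else \<zero>\<^bsub>M\<^esub>)"

lemma (in right_module) power_incl_hom: "power_incl M \<Lambda> i \<in> mod_hom R M (direct_power M \<Lambda>)"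
  unfolding power_incl_def
  by (rule mod_hom_restrictI)
    (auto simp: direct_power_def smult_zero right_module_axioms intro!: restrict_ext)

lemma power_component_hom:
  assumes "right_module R M" "i \<in> \<Lambda>"
  shows "(\<lambda>y\<in>carrier (direct_power M \<Lambda>). y i) \<in> mod_hom R (direct_power M \<Lambda>) M"
proof (rule mod_hom_restrictI)
  show "right_module R (direct_power M \<Lambda>)"
    by (rule right_module.right_module_direct_power[OF assms(1)])
qed (use assms(2) in \<open>auto simp: direct_power_def\<close>)

lemma (in right_module) power_decompose:
  assumes "finite \<Lambda>" "y \<in> carrier (direct_power M \<Lambda>)"
    and "abelian_group N" "\<psi> \<in> mod_hom R (direct_power M \<Lambda>) N"
  shows "\<psi> y = (\<Oplus>\<^bsub>N\<^esub>i\<in>\<Lambda>. \<psi> (power_incl M \<Lambda> i (y i)))"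
proof -
  interpret D: right_module R "direct_power M \<Lambda>" by (rule right_module_direct_power)
  have y: "y i \<in> carrier M" if "i \<in> \<Lambda>" for i using assms(2) that by (auto simp: direct_power_def)
  have incl: "power_incl M \<Lambda> i (y i) \<in> carrier (direct_power M \<Lambda>)" if "i \<in> \<Lambda>" for i
    by (rule mod_hom_closed[OF power_incl_hom y[OF that]])
  have "(\<Oplus>\<^bsub>direct_power M \<Lambda>\<^esub>i\<in>G. power_incl M \<Lambda> i (y i)) = (\<lambda>j\<in>\<Lambda>. if j \<in> G then y j else \<zero>\<^bsub>M\<^esub>)"
    if "finite G" "G \<subseteq> \<Lambda>" for G
    using that
  proof (induction G)
    case empty
    show ?case by (simp add: D.M.finsum_empty) (auto simp: direct_power_def)
  next
    case (insert i G)
    have "(\<Oplus>\<^bsub>direct_power M \<Lambda>\<^esub>i\<in>insert i G. power_incl M \<Lambda> i (y i)) =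
        power_incl M \<Lambda> i (y i) \<oplus>\<^bsub>direct_power M \<Lambda>\<^esub>
          (\<Oplus>\<^bsub>direct_power M \<Lambda>\<^esub>i\<in>G. power_incl M \<Lambda> i (y i))"
      by (rule D.M.finsum_insert) (use insert.hyps insert.prems incl in auto)
    also have "(\<Oplus>\<^bsub>direct_power M \<Lambda>\<^esub>i\<in>G. power_incl M \<Lambda> i (y i)) =
        (\<lambda>j\<in>\<Lambda>. if j \<in> G then y j else \<zero>\<^bsub>M\<^esub>)"
      by (rule insert.IH) (use insert.prems in blast)
    also have "power_incl M \<Lambda> i (y i) \<oplus>\<^bsub>direct_power M \<Lambda>\<^esub> (\<lambda>j\<in>\<Lambda>. if j \<in> G then y j else \<zero>\<^bsub>M\<^esub>) =
        (\<lambda>j\<in>\<Lambda>. if j \<in> insert i G then y j else \<zero>\<^bsub>M\<^esub>)"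
      using insert.hyps insert.prems y by (auto simp: direct_power_def power_incl_def intro!: restrict_ext)
    finally show ?case .
  qed
  from this[OF assms(1) subset_refl]
  have "(\<Oplus>\<^bsub>direct_power M \<Lambda>\<^esub>i\<in>\<Lambda>. power_incl M \<Lambda> i (y i)) = y"
    using assms(2) by (auto simp: direct_power_def PiE_iff extensional_def restrict_def)
  then show ?thesis
    using mod_hom_finsum[OF D.M.abelian_group_axioms assms(3,4,1), of "\<lambda>i. power_incl M \<Lambda> i (y i)"] incl
    by simp
qed

section \<open>Splittings and descending chains in the endomorphism ring\<close>

context right_module
begin

lemma endo_ring_apply:
  assumes "x \<in> carrier M"
  shows "(f \<otimes>\<^bsub>endo_ring R M\<^esub> g) x = f (g x)" "(f \<oplus>\<^bsub>endo_ring R M\<^esub> g) x = f x \<oplus>\<^bsub>M\<^esub> g x"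
    "\<zero>\<^bsub>endo_ring R M\<^esub> x = \<zero>\<^bsub>M\<^esub>"
  using assms by (simp_all add: endo_ring_def compose_def)

lemma endo_ring_carrier: "carrier (endo_ring R M) = mod_hom R M M"
  by (simp add: endo_ring_def)

lemma endo_ring_eqI:
  assumes "f \<in> carrier (endo_ring R M)" "g \<in> carrier (endo_ring R M)"
    "\<And>x. x \<in> carrier M \<Longrightarrow> f x = g x"
  shows "f = g"
  using assms by (auto simp: endo_ring_carrier mod_hom_def PiE_iff intro: extensionalityI)

lemma endo_ring_finsum_apply:
  assumes "finite F" "v \<in> F \<rightarrow> carrier (endo_ring R M)" "x \<in> carrier M"
  shows "(\<Oplus>\<^bsub>endo_ring R M\<^esub>i\<in>F. v i) x = (\<Oplus>\<^bsub>M\<^esub>i\<in>F. v i x)"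
  using assms(1,2)
proof (induction F)
  interpret S: ring "endo_ring R M" by (rule ring_endo_ring)
  case empty
  then show ?case using assms(3) by (simp add: endo_ring_apply)
next
  interpret S: ring "endo_ring R M" by (rule ring_endo_ring)
  case (insert i F)
  then have v: "v i \<in> carrier (endo_ring R M)" "v \<in> F \<rightarrow> carrier (endo_ring R M)" by auto
  have vx: "v i x \<in> carrier M" "(\<lambda>i. v i x) \<in> F \<rightarrow> carrier M"
    using v mod_hom_closed[OF _ assms(3)] by (auto simp: endo_ring_carrier)
  show ?case using insert v vx assms(3) by (simp add: endo_ring_apply)
qed

text \<open>\<open>\<epsilon>\<close> is the matrix of a projection onto the set of all families
  \<open>(\<beta> i x)\<close>. The projection fixes these families, which is the first identity. A
  row \<open>s\<close> that kills all of them also kills the projection, which is the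
  second.\<close>

lemma power_split:
  assumes \<Lambda>: "finite \<Lambda>" "\<Lambda> \<noteq> {}" and \<beta>: "\<And>i. i \<in> \<Lambda> \<Longrightarrow> \<beta> i \<in> mod_hom R M M"
    and rickart: "d_rickart R (direct_power M \<Lambda>)"
  shows "\<exists>\<epsilon>. (\<forall>i\<in>\<Lambda>. \<forall>j\<in>\<Lambda>. \<epsilon> i j \<in> mod_hom R M M) \<and>
    (\<forall>i\<in>\<Lambda>. \<forall>x\<in>carrier M. (\<Oplus>\<^bsub>M\<^esub>j\<in>\<Lambda>. \<epsilon> i j (\<beta> j x)) = \<beta> i x) \<and>
    (\<forall>s\<in>\<Lambda> \<rightarrow> mod_hom R M M. (\<forall>x\<in>carrier M. (\<Oplus>\<^bsub>M\<^esub>j\<in>\<Lambda>. s j (\<beta> j x)) = \<zero>\<^bsub>M\<^esub>) \<longrightarrow>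
      (\<forall>j\<in>\<Lambda>. \<forall>x\<in>carrier M. (\<Oplus>\<^bsub>M\<^esub>i\<in>\<Lambda>. s i (\<epsilon> i j x)) = \<zero>\<^bsub>M\<^esub>))"
proof -
  let ?D = "direct_power M \<Lambda>"
  interpret D: right_module R ?D by (rule right_module_direct_power)
  obtain k where k: "k \<in> \<Lambda>" using \<Lambda> by blast
  have D_carrier: "carrier ?D = \<Lambda> \<rightarrow>\<^sub>E carrier M" using \<Lambda>(1) by (simp add: direct_power_def)
  \<comment> \<open>The d-Rickart property speaks of endomorphisms, so the map from \<open>M\<close>
    to its power is preceded by the component at one fixed index \<open>k\<close>. That component is
    surjective, so the image stays the same.\<close>
  define \<phi> where "\<phi> = (\<lambda>y\<in>carrier ?D. \<lambda>i\<in>\<Lambda>. \<beta> i (y k))"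
  have "\<phi> \<in> mod_hom R ?D ?D"
    unfolding \<phi>_def
  proof (rule mod_hom_restrictI)
    fix y assume y: "y \<in> carrier ?D"
    then show "(\<lambda>i\<in>\<Lambda>. \<beta> i (y k)) \<in> carrier ?D"
      using k by (auto simp: D_carrier PiE_iff intro!: mod_hom_closed[OF \<beta>])
  next
    fix y z assume "y \<in> carrier ?D" "z \<in> carrier ?D"
    then have "y k \<in> carrier M" "z k \<in> carrier M" using k by (auto simp: D_carrier)
    then show "(\<lambda>i\<in>\<Lambda>. \<beta> i ((y \<oplus>\<^bsub>?D\<^esub> z) k)) = (\<lambda>i\<in>\<Lambda>. \<beta> i (y k)) \<oplus>\<^bsub>?D\<^esub> (\<lambda>i\<in>\<Lambda>. \<beta> i (z k))"
      using k by (auto simp: direct_power_def mod_hom_add[OF \<beta>] intro!: restrict_ext)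
  next
    fix a y assume "a \<in> carrier R" "y \<in> carrier ?D"
    then have "y k \<in> carrier M" "a \<in> carrier R" using k by (auto simp: D_carrier)
    then show "(\<lambda>i\<in>\<Lambda>. \<beta> i ((a \<odot>\<^bsub>?D\<^esub> y) k)) = a \<odot>\<^bsub>?D\<^esub> (\<lambda>i\<in>\<Lambda>. \<beta> i (y k))"
      using k by (auto simp: direct_power_def mod_hom_smult[OF \<beta>] intro!: restrict_ext)
  qed (rule D.right_module_axioms)
  then have "direct_summand R ?D (\<phi> ` carrier ?D)" using rickart by (simp add: d_rickart_def)
  then obtain \<pi> where \<pi>: "\<pi> \<in> mod_hom R ?D ?D" "\<And>y. y \<in> carrier ?D \<Longrightarrow> \<pi> y \<in> \<phi> ` carrier ?D"
    "\<And>y. y \<in> \<phi> ` carrier ?D \<Longrightarrow> \<pi> y = y"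
    using D.direct_summand_projection by blast
  have image: "\<phi> ` carrier ?D = (\<lambda>x. \<lambda>i\<in>\<Lambda>. \<beta> i x) ` carrier M"
  proof
    show "\<phi> ` carrier ?D \<subseteq> (\<lambda>x. \<lambda>i\<in>\<Lambda>. \<beta> i x) ` carrier M" using k by (auto simp: \<phi>_def D_carrier)
    have "(\<lambda>i\<in>\<Lambda>. \<beta> i x) = \<phi> (\<lambda>i\<in>\<Lambda>. x)" "(\<lambda>i\<in>\<Lambda>. x) \<in> carrier ?D" if "x \<in> carrier M" for x
      using that k by (auto simp: \<phi>_def D_carrier)
    then show "(\<lambda>x. \<lambda>i\<in>\<Lambda>. \<beta> i x) ` carrier M \<subseteq> \<phi> ` carrier ?D" by blast
  qed
  define \<epsilon> where "\<epsilon> i j = (\<lambda>x\<in>carrier M. \<pi> (power_incl M \<Lambda> j x) i)" for i j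
  have component: "(\<lambda>y\<in>carrier ?D. \<pi> y i) \<in> mod_hom R ?D M" if i: "i \<in> \<Lambda>" for i
  proof -
    have "(\<lambda>y\<in>carrier ?D. (\<lambda>y\<in>carrier ?D. y i) (\<pi> y)) \<in> mod_hom R ?D M"
      by (rule mod_hom_comp[OF \<pi>(1) power_component_hom[OF right_module_axioms i] D.right_module_axioms])
    moreover have "(\<lambda>y\<in>carrier ?D. (\<lambda>y\<in>carrier ?D. y i) (\<pi> y)) = (\<lambda>y\<in>carrier ?D. \<pi> y i)"
      by (rule restrict_ext) (simp add: mod_hom_closed[OF \<pi>(1)])
    ultimately show ?thesis by simp
  qed
  have incl: "power_incl M \<Lambda> j x \<in> carrier ?D" if "x \<in> carrier M" for j x
    using mod_hom_closed[OF power_incl_hom that] .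
  have \<epsilon>_hom: "\<epsilon> i j \<in> mod_hom R M M" if "i \<in> \<Lambda>" for i j
  proof -
    have "(\<lambda>x\<in>carrier M. (\<lambda>y\<in>carrier ?D. \<pi> y i) (power_incl M \<Lambda> j x)) \<in> mod_hom R M M"
      by (rule mod_hom_comp[OF power_incl_hom component[OF that] right_module_axioms])
    moreover have "(\<lambda>x\<in>carrier M. (\<lambda>y\<in>carrier ?D. \<pi> y i) (power_incl M \<Lambda> j x)) = \<epsilon> i j"
      unfolding \<epsilon>_def by (rule restrict_ext) (simp add: incl)
    ultimately show ?thesis by simp
  qed
  have "(\<Oplus>\<^bsub>M\<^esub>j\<in>\<Lambda>. \<epsilon> i j (\<beta> j x)) = \<beta> i x" if i: "i \<in> \<Lambda>" and x: "x \<in> carrier M" for i x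
  proof -
    let ?y = "\<lambda>j\<in>\<Lambda>. \<beta> j x"
    have \<beta>x: "\<beta> j x \<in> carrier M" if "j \<in> \<Lambda>" for j using mod_hom_closed[OF \<beta>[OF that] x] .
    have y: "?y \<in> carrier ?D" "?y \<in> \<phi> ` carrier ?D" using x \<beta>x unfolding image by (auto simp: D_carrier)
    have "\<beta> i x = (\<lambda>y\<in>carrier ?D. \<pi> y i) ?y" using y \<pi>(3) i by simp
    also have "\<dots> = (\<Oplus>\<^bsub>M\<^esub>j\<in>\<Lambda>. (\<lambda>y\<in>carrier ?D. \<pi> y i) (power_incl M \<Lambda> j (?y j)))"
      by (rule power_decompose[OF \<Lambda>(1) y(1) M.abelian_group_axioms component[OF i]])
    also have "\<dots> = (\<Oplus>\<^bsub>M\<^esub>j\<in>\<Lambda>. \<epsilon> i j (\<beta> j x))"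
    proof (rule M.finsum_cong')
      show "(\<lambda>j. \<epsilon> i j (\<beta> j x)) \<in> \<Lambda> \<rightarrow> carrier M"
        by (rule Pi_I) (rule mod_hom_closed[OF \<epsilon>_hom[OF i] \<beta>x])
    qed (use \<beta>x incl in \<open>auto simp: \<epsilon>_def\<close>)
    finally show ?thesis by simp
  qed
  moreover have "(\<Oplus>\<^bsub>M\<^esub>i\<in>\<Lambda>. s i (\<epsilon> i j x)) = \<zero>\<^bsub>M\<^esub>"
    if s: "s \<in> \<Lambda> \<rightarrow> mod_hom R M M" "\<forall>x\<in>carrier M. (\<Oplus>\<^bsub>M\<^esub>j\<in>\<Lambda>. s j (\<beta> j x)) = \<zero>\<^bsub>M\<^esub>"
      and j: "j \<in> \<Lambda>" and x: "x \<in> carrier M" for s j x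
  proof -
    have "\<pi> (power_incl M \<Lambda> j x) \<in> (\<lambda>x. \<lambda>i\<in>\<Lambda>. \<beta> i x) ` carrier M"
      using \<pi>(2)[OF incl[OF x]] by (simp only: image)
    then obtain z where z: "z \<in> carrier M" "\<pi> (power_incl M \<Lambda> j x) = (\<lambda>i\<in>\<Lambda>. \<beta> i z)" by blast
    have "(\<Oplus>\<^bsub>M\<^esub>i\<in>\<Lambda>. s i (\<epsilon> i j x)) = (\<Oplus>\<^bsub>M\<^esub>i\<in>\<Lambda>. s i (\<beta> i z))"
    proof (rule M.finsum_cong')
      show "(\<lambda>i. s i (\<beta> i z)) \<in> \<Lambda> \<rightarrow> carrier M"
      proof
        fix i assume i: "i \<in> \<Lambda>"
        show "s i (\<beta> i z) \<in> carrier M"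
          by (rule mod_hom_closed[OF _ mod_hom_closed[OF \<beta>[OF i] z(1)]]) (use s(1) i in blast)
      qed
    qed (use x z in \<open>auto simp: \<epsilon>_def\<close>)
    then show ?thesis using s(2) z(1) by simp
  qed
  ultimately show ?thesis using \<epsilon>_hom by (intro exI[of _ \<epsilon>]) blast
qed

lemma endo_ring_split:
  assumes "infinite (UNIV :: 'i set)" "sigma_d_rickart TYPE('i) R M"
    and F: "finite F" "F \<subseteq> carrier (endo_ring R M)"
  defines "S \<equiv> endo_ring R M"
  shows "\<exists>\<epsilon>\<in>F \<rightarrow> F \<rightarrow> carrier S. (\<forall>c\<in>F. (\<Oplus>\<^bsub>S\<^esub>b\<in>F. \<epsilon> c b \<otimes>\<^bsub>S\<^esub> b) = c) \<and>
    (\<forall>s\<in>F \<rightarrow> carrier S. (\<Oplus>\<^bsub>S\<^esub>b\<in>F. s b \<otimes>\<^bsub>S\<^esub> b) = \<zero>\<^bsub>S\<^esub> \<longrightarrow>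
      (\<forall>b\<in>F. (\<Oplus>\<^bsub>S\<^esub>c\<in>F. s c \<otimes>\<^bsub>S\<^esub> \<epsilon> c b) = \<zero>\<^bsub>S\<^esub>))"
\<comment> \<open>Only non-empty index sets are available, so the empty family is treated
  apart.\<close>
proof (cases "F = {}")
  case True
  then show ?thesis by auto
next
  case False
  interpret S: ring S unfolding S_def by (rule ring_endo_ring)
  \<comment> \<open>\<open>F\<close> consists of endomorphisms and is not a set of indices, so it is
    copied into the index type, whose infinity provides room for any finite cardinality.\<close>
  obtain \<Lambda> :: "'i set" where \<Lambda>: "finite \<Lambda>" "card \<Lambda> = card F"
    using infinite_arbitrarily_large[OF assms(1), of "card F"] by auto
  obtain g where g: "bij_betw g F \<Lambda>" using finite_same_card_bij[OF F(1) \<Lambda>(1)] \<Lambda>(2) by auto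
  have inj: "inj_on g F" and img: "\<Lambda> = g ` F" using g by (auto simp: bij_betw_def)
  define \<beta> where "\<beta> = inv_into F g"
  have \<beta>g: "\<beta> (g c) = c" if "c \<in> F" for c using that inj by (simp add: \<beta>_def)
  have Fh: "F \<subseteq> mod_hom R M M" using F(2) by (simp add: endo_ring_carrier)
  have \<beta>: "\<beta> i \<in> mod_hom R M M" if "i \<in> \<Lambda>" for i using that \<beta>g Fh by (auto simp: img)
  have ne: "\<Lambda> \<noteq> {}" using False img by simp
  have "d_rickart R (direct_power M \<Lambda>)" using assms(2) ne by (simp add: sigma_d_rickart_def)
  from power_split[of \<Lambda> \<beta>, OF \<Lambda>(1) ne \<beta> this] obtain \<epsilon> where
    \<epsilon>: "\<forall>i\<in>\<Lambda>. \<forall>j\<in>\<Lambda>. \<epsilon> i j \<in> mod_hom R M M"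
      "\<forall>i\<in>\<Lambda>. \<forall>x\<in>carrier M. (\<Oplus>\<^bsub>M\<^esub>j\<in>\<Lambda>. \<epsilon> i j (\<beta> j x)) = \<beta> i x"
    and ker: "\<forall>s\<in>\<Lambda> \<rightarrow> mod_hom R M M. (\<forall>x\<in>carrier M. (\<Oplus>\<^bsub>M\<^esub>j\<in>\<Lambda>. s j (\<beta> j x)) = \<zero>\<^bsub>M\<^esub>) \<longrightarrow>
      (\<forall>j\<in>\<Lambda>. \<forall>x\<in>carrier M. (\<Oplus>\<^bsub>M\<^esub>i\<in>\<Lambda>. s i (\<epsilon> i j x)) = \<zero>\<^bsub>M\<^esub>)"
    by blast
  define \<eta> where "\<eta> c b = \<epsilon> (g c) (g b)" for b c
  have hom_S: "f \<in> carrier S \<longleftrightarrow> f \<in> mod_hom R M M" for f by (simp add: S_def endo_ring_carrier)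
  have \<eta>: "\<eta> c b \<in> carrier S" if "c \<in> F" "b \<in> F" for b c
    using \<epsilon>(1) that by (simp add: \<eta>_def hom_S img)
  have bS: "b \<in> carrier S" if "b \<in> F" for b using that Fh hom_S by blast
  have sum_apply: "(\<Oplus>\<^bsub>S\<^esub>b\<in>F. u b \<otimes>\<^bsub>S\<^esub> v b) x = (\<Oplus>\<^bsub>M\<^esub>i\<in>\<Lambda>. u (\<beta> i) (v (\<beta> i) x))"
    if u: "\<And>b. b \<in> F \<Longrightarrow> u b \<in> carrier S" and v: "\<And>b. b \<in> F \<Longrightarrow> v b \<in> carrier S"
      and x: "x \<in> carrier M" for u v x
  proof -
    have uv: "u b (v b x) \<in> carrier M" if "b \<in> F" for b
      using mod_hom_closed[OF u[OF that, unfolded hom_S] mod_hom_closed[OF v[OF that, unfolded hom_S] x]] .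
    have "(\<Oplus>\<^bsub>S\<^esub>b\<in>F. u b \<otimes>\<^bsub>S\<^esub> v b) x = (\<Oplus>\<^bsub>M\<^esub>b\<in>F. (u b \<otimes>\<^bsub>S\<^esub> v b) x)"
      unfolding S_def
      by (rule endo_ring_finsum_apply[OF F(1) _ x]) (use u v S.m_closed in \<open>auto simp: S_def\<close>)
    also have "\<dots> = (\<Oplus>\<^bsub>M\<^esub>b\<in>F. u (\<beta> (g b)) (v (\<beta> (g b)) x))"
      by (rule M.finsum_cong') (use uv x \<beta>g in \<open>auto simp: S_def endo_ring_apply\<close>)
    also have "\<dots> = (\<Oplus>\<^bsub>M\<^esub>i\<in>\<Lambda>. u (\<beta> i) (v (\<beta> i) x))"
      unfolding img by (rule M.finsum_reindex[OF _ inj, symmetric]) (use uv \<beta>g in auto)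
    finally show ?thesis .
  qed
  have sum_closed: "(\<Oplus>\<^bsub>S\<^esub>b\<in>F. u b \<otimes>\<^bsub>S\<^esub> v b) \<in> carrier S"
    if u: "\<And>b. b \<in> F \<Longrightarrow> u b \<in> carrier S" and v: "\<And>b. b \<in> F \<Longrightarrow> v b \<in> carrier S" for u v
    by (rule S.finsum_closed) (use u v in auto)
  have \<beta>F: "\<beta> i \<in> F" "g (\<beta> i) = i" if "i \<in> \<Lambda>" for i using that \<beta>g by (auto simp: img)
  have "(\<Oplus>\<^bsub>S\<^esub>b\<in>F. \<eta> c b \<otimes>\<^bsub>S\<^esub> b) = c" if c: "c \<in> F" for c
  proof (rule endo_ring_eqI)
    show "(\<Oplus>\<^bsub>S\<^esub>b\<in>F. \<eta> c b \<otimes>\<^bsub>S\<^esub> b) \<in> carrier (endo_ring R M)"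
      using sum_closed[of "\<eta> c" "\<lambda>b. b"] \<eta> bS c by (simp add: S_def)
    show "c \<in> carrier (endo_ring R M)" using bS[OF c] by (simp add: S_def)
    fix x assume x: "x \<in> carrier M"
    have "(\<Oplus>\<^bsub>S\<^esub>b\<in>F. \<eta> c b \<otimes>\<^bsub>S\<^esub> b) x = (\<Oplus>\<^bsub>M\<^esub>i\<in>\<Lambda>. \<eta> c (\<beta> i) (\<beta> i x))"
      by (rule sum_apply) (use \<eta> bS c x in auto)
    also have "\<dots> = (\<Oplus>\<^bsub>M\<^esub>i\<in>\<Lambda>. \<epsilon> (g c) i (\<beta> i x))"
    proof (rule M.finsum_cong')
      show "(\<lambda>i. \<epsilon> (g c) i (\<beta> i x)) \<in> \<Lambda> \<rightarrow> carrier M"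
      proof
        fix i assume i: "i \<in> \<Lambda>"
        show "\<epsilon> (g c) i (\<beta> i x) \<in> carrier M"
          by (rule mod_hom_closed[OF _ mod_hom_closed[OF \<beta>[OF i] x]]) (use \<epsilon>(1) c i img in blast)
      qed
    qed (use \<beta>F in \<open>auto simp: \<eta>_def\<close>)
    also have "\<dots> = c x" using \<epsilon>(2) c x \<beta>g by (simp add: img)
    finally show "(\<Oplus>\<^bsub>S\<^esub>b\<in>F. \<eta> c b \<otimes>\<^bsub>S\<^esub> b) x = c x" .
  qed
  moreover have "(\<Oplus>\<^bsub>S\<^esub>c\<in>F. s c \<otimes>\<^bsub>S\<^esub> \<eta> c b) = \<zero>\<^bsub>S\<^esub>"
    if s: "s \<in> F \<rightarrow> carrier S" "(\<Oplus>\<^bsub>S\<^esub>b\<in>F. s b \<otimes>\<^bsub>S\<^esub> b) = \<zero>\<^bsub>S\<^esub>" and b: "b \<in> F" for s b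
  proof (rule endo_ring_eqI)
    have sS: "s c \<in> carrier S" if "c \<in> F" for c using s(1) that by blast
    show "(\<Oplus>\<^bsub>S\<^esub>c\<in>F. s c \<otimes>\<^bsub>S\<^esub> \<eta> c b) \<in> carrier (endo_ring R M)"
      using sum_closed[of s "\<lambda>c. \<eta> c b"] sS \<eta> b by (simp add: S_def)
    show "\<zero>\<^bsub>S\<^esub> \<in> carrier (endo_ring R M)" using S.zero_closed by (simp add: S_def)
    fix x assume x: "x \<in> carrier M"
    have s\<beta>: "(\<lambda>i. s (\<beta> i)) \<in> \<Lambda> \<rightarrow> mod_hom R M M" using sS \<beta>F hom_S by auto
    have "(\<Oplus>\<^bsub>M\<^esub>i\<in>\<Lambda>. s (\<beta> i) (\<beta> i y)) = \<zero>\<^bsub>M\<^esub>" if y: "y \<in> carrier M" for y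
    proof -
      have "(\<Oplus>\<^bsub>S\<^esub>b\<in>F. s b \<otimes>\<^bsub>S\<^esub> b) y = (\<Oplus>\<^bsub>M\<^esub>i\<in>\<Lambda>. s (\<beta> i) (\<beta> i y))"
        by (rule sum_apply) (use sS bS y in auto)
      then show ?thesis using s(2) y by (simp add: S_def endo_ring_apply)
    qed
    then have 0: "(\<Oplus>\<^bsub>M\<^esub>i\<in>\<Lambda>. s (\<beta> i) (\<epsilon> i (g b) x)) = \<zero>\<^bsub>M\<^esub>"
      using bspec[OF ker s\<beta>] b x by (simp add: img)
    have "(\<Oplus>\<^bsub>S\<^esub>c\<in>F. s c \<otimes>\<^bsub>S\<^esub> \<eta> c b) x = (\<Oplus>\<^bsub>M\<^esub>i\<in>\<Lambda>. s (\<beta> i) (\<eta> (\<beta> i) b x))"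
      by (rule sum_apply) (use sS \<eta> b x in auto)
    also have "\<dots> = (\<Oplus>\<^bsub>M\<^esub>i\<in>\<Lambda>. s (\<beta> i) (\<epsilon> i (g b) x))"
    proof (rule M.finsum_cong')
      show "(\<lambda>i. s (\<beta> i) (\<epsilon> i (g b) x)) \<in> \<Lambda> \<rightarrow> carrier M"
      proof
        fix i assume i: "i \<in> \<Lambda>"
        have "s (\<beta> i) \<in> mod_hom R M M" "\<epsilon> i (g b) \<in> mod_hom R M M"
          using s\<beta> \<epsilon>(1) b i by (auto simp: img)
        then show "s (\<beta> i) (\<epsilon> i (g b) x) \<in> carrier M"
          by (intro mod_hom_closed[OF _ mod_hom_closed[OF _ x]])
      qed
    qed (use \<beta>F in \<open>auto simp: \<eta>_def\<close>)
    finally show "(\<Oplus>\<^bsub>S\<^esub>c\<in>F. s c \<otimes>\<^bsub>S\<^esub> \<eta> c b) x = \<zero>\<^bsub>S\<^esub> x"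
      using 0 x by (simp add: S_def endo_ring_apply)
  qed
  ultimately show ?thesis using \<eta> by (intro bexI[of _ \<eta>]) auto
qed

text \<open>The images of finitely many generators have finite supports, so some coordinate vanishes
  on all of them; the kernel of that coordinate is a submodule and hence everything. This is where
  finite generation enters.\<close>

lemma finitely_generated_power_component:
  assumes "finitely_generated R M" "\<theta> \<in> mod_hom R M (direct_power M (range g))" "inj g"
  obtains n :: nat where "\<And>x. x \<in> carrier M \<Longrightarrow> \<theta> x (g n) = \<zero>\<^bsub>M\<^esub>"
proof -
  let ?D = "direct_power M (range g)"
  interpret D: right_module R ?D by (rule right_module_direct_power)
  obtain B where B: "finite B" "B \<subseteq> carrier M" "\<Inter>{N. submodule N R M \<and> B \<subseteq> N} = carrier M"
    using assms(1) by (auto simp: finitely_generated_def)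
  have "finite {i \<in> range g. \<theta> x i \<noteq> \<zero>\<^bsub>M\<^esub>}" if "x \<in> B" for x
    using mod_hom_closed[OF assms(2), of x] B(2) that by (auto simp: direct_power_def)
  then have "finite (\<Union>x\<in>B. {i \<in> range g. \<theta> x i \<noteq> \<zero>\<^bsub>M\<^esub>})" using B(1) by blast
  then have "infinite (range g - (\<Union>x\<in>B. {i \<in> range g. \<theta> x i \<noteq> \<zero>\<^bsub>M\<^esub>}))"
    by (rule Diff_infinite_finite) (use assms(3) finite_imageD infinite_UNIV_nat in blast)
  then have "range g - (\<Union>x\<in>B. {i \<in> range g. \<theta> x i \<noteq> \<zero>\<^bsub>M\<^esub>}) \<noteq> {}"
    by (rule infinite_imp_nonempty)
  then obtain n where n: "\<And>x. x \<in> B \<Longrightarrow> \<theta> x (g n) = \<zero>\<^bsub>M\<^esub>" by blast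
  define p where "p = (\<lambda>x\<in>carrier M. (\<lambda>y\<in>carrier ?D. y (g n)) (\<theta> x))"
  have p: "p \<in> mod_hom R M M"
    unfolding p_def
    by (rule mod_hom_comp[OF assms(2) power_component_hom[OF right_module_axioms] right_module_axioms]) simp
  have p_eq: "p x = \<theta> x (g n)" if "x \<in> carrier M" for x
    using that mod_hom_closed[OF assms(2) that] by (simp add: p_def)
  have p0: "p \<zero>\<^bsub>M\<^esub> = \<zero>\<^bsub>M\<^esub>" by (rule mod_hom_zero[OF M.abelian_group_axioms M.abelian_group_axioms p])
  let ?N = "{x \<in> carrier M. p x = \<zero>\<^bsub>M\<^esub>}"
  have p_minus: "p (\<ominus>\<^bsub>M\<^esub> x) = \<zero>\<^bsub>M\<^esub>" if x: "x \<in> carrier M" "p x = \<zero>\<^bsub>M\<^esub>" for x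
  proof -
    have "p (\<ominus>\<^bsub>M\<^esub> x \<oplus>\<^bsub>M\<^esub> x) = p (\<ominus>\<^bsub>M\<^esub> x) \<oplus>\<^bsub>M\<^esub> p x" using x by (intro mod_hom_add[OF p]) auto
    then show ?thesis using x p0 mod_hom_closed[OF p, of "\<ominus>\<^bsub>M\<^esub> x"] by (simp add: M.l_neg)
  qed
  have "submodule ?N R M"
  proof (intro submodule.intro submodule_axioms.intro subgroup.intro)
    show "inv\<^bsub>add_monoid M\<^esub> x \<in> ?N" if "x \<in> ?N" for x
      using that p_minus by (simp add: a_inv_def[symmetric])
  qed (auto simp: p0 mod_hom_add[OF p] mod_hom_smult[OF p] smult_closed smult_zero)
  moreover have "B \<subseteq> ?N" using B(2) n p_eq by auto
  ultimately have "carrier M \<subseteq> ?N" using B(3) by blast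
  then have "\<theta> x (g n) = \<zero>\<^bsub>M\<^esub>" if "x \<in> carrier M" for x using that p_eq[OF that] by auto
  then show thesis using that by blast
qed

text \<open>Bass's argument: the injective endomorphism \<open>\<phi>\<close> of the direct power subtracts from each
  coordinate the image of the previous one under the sequence of maps, and its cokernel is the
  direct limit of that sequence.\<close>

lemma principal_chain_stable:
  fixes g :: "nat \<Rightarrow> 'i"
  assumes fg: "finitely_generated R M" and g: "inj g"
    and rickart: "d_rickart R (direct_power M (range g))"
    and a: "\<And>n. a n \<in> mod_hom R M M" and c: "\<And>n. c n \<in> mod_hom R M M"
    and c_Suc: "\<And>n x. x \<in> carrier M \<Longrightarrow> c (Suc n) x = a n (c n x)"
  shows "\<exists>n. \<exists>u\<in>mod_hom R M M. \<forall>x\<in>carrier M. c n x \<oplus>\<^bsub>M\<^esub> u (c (Suc n) x) = \<zero>\<^bsub>M\<^esub>"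
proof -
  let ?D = "direct_power M (range g)"
  interpret D: right_module R ?D by (rule right_module_direct_power)
  have D_closed: "y (g k) \<in> carrier M" if "y \<in> carrier ?D" for y k
    using that by (auto simp: direct_power_def)
  have D_fin: "finite {k. y (g k) \<noteq> \<zero>\<^bsub>M\<^esub>}" if "y \<in> carrier ?D" for y
  proof (rule finite_imageD)
    show "finite (g ` {k. y (g k) \<noteq> \<zero>\<^bsub>M\<^esub>})"
      by (rule finite_subset[of _ "{i \<in> range g. y i \<noteq> \<zero>\<^bsub>M\<^esub>}"])
        (use that in \<open>auto simp: direct_power_def\<close>)
  qed (use g in \<open>auto intro: inj_on_subset\<close>)
  define seq where "seq v = (\<lambda>i\<in>range g. v (inv_into UNIV g i))" for v :: "nat \<Rightarrow> 'm"
  have seq_apply: "seq v (g k) = v k" for v k using g by (simp add: seq_def)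
  have seqI: "seq v \<in> carrier ?D" if "\<And>k. v k \<in> carrier M" "finite {k. v k \<noteq> \<zero>\<^bsub>M\<^esub>}" for v
  proof -
    have "{i \<in> range g. seq v i \<noteq> \<zero>\<^bsub>M\<^esub>} = g ` {k. v k \<noteq> \<zero>\<^bsub>M\<^esub>}"
      by (auto simp: seq_apply)
    moreover have "seq v \<in> range g \<rightarrow>\<^sub>E carrier M" using that(1) by (simp add: seq_def)
    ultimately show ?thesis using that(2) by (simp add: direct_power_def)
  qed
  have D_eqI: "y = z" if "y \<in> carrier ?D" "z \<in> carrier ?D" "\<And>k. y (g k) = z (g k)" for y z
  proof (rule extensionalityI[of _ "range g"])
    show "y i = z i" if "i \<in> range g" for i using that \<open>\<And>k. y (g k) = z (g k)\<close> by auto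
  qed (use that in \<open>auto simp: direct_power_def PiE_iff\<close>)
  have D_add: "(y \<oplus>\<^bsub>?D\<^esub> z) (g k) = y (g k) \<oplus>\<^bsub>M\<^esub> z (g k)" for y z k
    by (simp add: direct_power_def)
  have D_smult: "(r \<odot>\<^bsub>?D\<^esub> y) (g k) = r \<odot>\<^bsub>M\<^esub> y (g k)" for r y k
    by (simp add: direct_power_def)
  have incl_apply: "power_incl M (range g) (g n) x (g k) = (if k = n then x else \<zero>\<^bsub>M\<^esub>)"
    if "x \<in> carrier M" for n k x
    using that g by (auto simp: power_incl_def inj_eq)
  have a0: "a n \<zero>\<^bsub>M\<^esub> = \<zero>\<^bsub>M\<^esub>" for n
    by (rule mod_hom_zero[OF M.abelian_group_axioms M.abelian_group_axioms a])
  define shift where "shift y k = (case k of 0 \<Rightarrow> \<zero>\<^bsub>M\<^esub> | Suc l \<Rightarrow> a l (y (g l)))" for y k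
  have shift_closed: "shift y k \<in> carrier M" if "y \<in> carrier ?D" for y k
    using mod_hom_closed[OF a D_closed[OF that]] by (cases k) (auto simp: shift_def)
  have shift_add: "shift (y \<oplus>\<^bsub>?D\<^esub> z) k = shift y k \<oplus>\<^bsub>M\<^esub> shift z k"
    if "y \<in> carrier ?D" "z \<in> carrier ?D" for y z k
    using D_closed that by (cases k) (auto simp: shift_def D_add mod_hom_add[OF a])
  have shift_smult: "shift (r \<odot>\<^bsub>?D\<^esub> y) k = r \<odot>\<^bsub>M\<^esub> shift y k"
    if "r \<in> carrier R" "y \<in> carrier ?D" for r y k
    using D_closed that by (cases k) (auto simp: shift_def D_smult mod_hom_smult[OF a] smult_zero)
  define \<phi> where "\<phi> = (\<lambda>y\<in>carrier ?D. seq (\<lambda>k. y (g k) \<oplus>\<^bsub>M\<^esub> \<ominus>\<^bsub>M\<^esub> shift y k))"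
  have \<phi>_closed: "seq (\<lambda>k. y (g k) \<oplus>\<^bsub>M\<^esub> \<ominus>\<^bsub>M\<^esub> shift y k) \<in> carrier ?D" if y: "y \<in> carrier ?D" for y
  proof (rule seqI)
    show "y (g k) \<oplus>\<^bsub>M\<^esub> \<ominus>\<^bsub>M\<^esub> shift y k \<in> carrier M" for k
      using D_closed shift_closed y by simp
    have "{k. y (g k) \<oplus>\<^bsub>M\<^esub> \<ominus>\<^bsub>M\<^esub> shift y k \<noteq> \<zero>\<^bsub>M\<^esub>} \<subseteq>
        {k. y (g k) \<noteq> \<zero>\<^bsub>M\<^esub>} \<union> Suc ` {k. y (g k) \<noteq> \<zero>\<^bsub>M\<^esub>}"
    proof
      fix k assume k: "k \<in> {k. y (g k) \<oplus>\<^bsub>M\<^esub> \<ominus>\<^bsub>M\<^esub> shift y k \<noteq> \<zero>\<^bsub>M\<^esub>}"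
      show "k \<in> {k. y (g k) \<noteq> \<zero>\<^bsub>M\<^esub>} \<union> Suc ` {k. y (g k) \<noteq> \<zero>\<^bsub>M\<^esub>}"
        using k by (cases k) (auto simp: shift_def a0)
    qed
    then show "finite {k. y (g k) \<oplus>\<^bsub>M\<^esub> \<ominus>\<^bsub>M\<^esub> shift y k \<noteq> \<zero>\<^bsub>M\<^esub>}"
      using D_fin[OF y] by (meson finite_UnI finite_imageI finite_subset)
  qed
  have \<phi>_apply: "\<phi> y (g k) = y (g k) \<oplus>\<^bsub>M\<^esub> \<ominus>\<^bsub>M\<^esub> shift y k" if "y \<in> carrier ?D" for y k
    using that by (simp add: \<phi>_def seq_apply)
  have \<phi>: "\<phi> \<in> mod_hom R ?D ?D"
    unfolding \<phi>_def
  proof (rule mod_hom_restrictI[OF \<phi>_closed _ _ D.right_module_axioms])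
    fix y z assume y: "y \<in> carrier ?D" and z: "z \<in> carrier ?D"
    show "seq (\<lambda>k. (y \<oplus>\<^bsub>?D\<^esub> z) (g k) \<oplus>\<^bsub>M\<^esub> \<ominus>\<^bsub>M\<^esub> shift (y \<oplus>\<^bsub>?D\<^esub> z) k) =
        seq (\<lambda>k. y (g k) \<oplus>\<^bsub>M\<^esub> \<ominus>\<^bsub>M\<^esub> shift y k) \<oplus>\<^bsub>?D\<^esub> seq (\<lambda>k. z (g k) \<oplus>\<^bsub>M\<^esub> \<ominus>\<^bsub>M\<^esub> shift z k)"
    proof (rule D_eqI)
      fix k
      have "y (g k) \<in> carrier M" "z (g k) \<in> carrier M" "shift y k \<in> carrier M" "shift z k \<in> carrier M"
        using D_closed shift_closed y z by auto
      then show "seq (\<lambda>k. (y \<oplus>\<^bsub>?D\<^esub> z) (g k) \<oplus>\<^bsub>M\<^esub> \<ominus>\<^bsub>M\<^esub> shift (y \<oplus>\<^bsub>?D\<^esub> z) k) (g k) =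
          (seq (\<lambda>k. y (g k) \<oplus>\<^bsub>M\<^esub> \<ominus>\<^bsub>M\<^esub> shift y k) \<oplus>\<^bsub>?D\<^esub>
            seq (\<lambda>k. z (g k) \<oplus>\<^bsub>M\<^esub> \<ominus>\<^bsub>M\<^esub> shift z k)) (g k)"
        using y z by (simp add: D_add seq_apply shift_add M.minus_add M.a_ac)
    qed (use \<phi>_closed y z in auto)
  next
    fix r y assume r: "r \<in> carrier R" and y: "y \<in> carrier ?D"
    show "seq (\<lambda>k. (r \<odot>\<^bsub>?D\<^esub> y) (g k) \<oplus>\<^bsub>M\<^esub> \<ominus>\<^bsub>M\<^esub> shift (r \<odot>\<^bsub>?D\<^esub> y) k) =
        r \<odot>\<^bsub>?D\<^esub> seq (\<lambda>k. y (g k) \<oplus>\<^bsub>M\<^esub> \<ominus>\<^bsub>M\<^esub> shift y k)"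
    proof (rule D_eqI)
      fix k
      have "y (g k) \<in> carrier M" "shift y k \<in> carrier M"
        using D_closed shift_closed y by auto
      then show "seq (\<lambda>k. (r \<odot>\<^bsub>?D\<^esub> y) (g k) \<oplus>\<^bsub>M\<^esub> \<ominus>\<^bsub>M\<^esub> shift (r \<odot>\<^bsub>?D\<^esub> y) k) (g k) =
          (r \<odot>\<^bsub>?D\<^esub> seq (\<lambda>k. y (g k) \<oplus>\<^bsub>M\<^esub> \<ominus>\<^bsub>M\<^esub> shift y k)) (g k)"
        using r y by (simp add: D_smult seq_apply shift_smult smult_r_distr smult_minus)
    qed (use \<phi>_closed r y in \<open>auto intro: D.smult_closed\<close>)
  qed
  \<comment> \<open>\<open>\<phi>\<close> is triangular with the identity on the diagonal:
    coordinate \<open>k\<close> is recovered from \<open>\<phi> y\<close> and coordinate k -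
    1.\<close>
  have \<phi>_inj: "inj_on \<phi> (carrier ?D)"
  proof (rule inj_onI)
    fix y z assume y: "y \<in> carrier ?D" and z: "z \<in> carrier ?D" and eq: "\<phi> y = \<phi> z"
    have step: "y (g k) = z (g k)" if "shift y k = shift z k" for k
    proof -
      have "y (g k) \<oplus>\<^bsub>M\<^esub> \<ominus>\<^bsub>M\<^esub> shift z k = z (g k) \<oplus>\<^bsub>M\<^esub> \<ominus>\<^bsub>M\<^esub> shift z k"
        using arg_cong[OF eq, of "\<lambda>f. f (g k)"] that by (simp add: \<phi>_apply y z)
      then show ?thesis
        using M.add.right_cancel[of "\<ominus>\<^bsub>M\<^esub> shift z k"] D_closed y z shift_closed[OF z, of k] by simp
    qed
    have "y (g k) = z (g k)" for k
      by (induction k) (rule step, simp add: shift_def)+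
    then show "y = z" by (rule D_eqI[OF y z])
  qed
  have "direct_summand R ?D (\<phi> ` carrier ?D)" using rickart \<phi> by (simp add: d_rickart_def)
  then obtain \<psi> where \<psi>: "\<psi> \<in> mod_hom R ?D ?D" "\<And>y. y \<in> carrier ?D \<Longrightarrow> \<psi> (\<phi> y) = y"
    by (rule split_injection[OF D.right_module_axioms D.right_module_axioms \<phi> \<phi>_inj]) blast
  let ?\<iota> = "\<lambda>n. power_incl M (range g) (g n)"
  have \<iota>: "?\<iota> n x \<in> carrier ?D" if "x \<in> carrier M" for n x
    by (rule mod_hom_closed[OF power_incl_hom that])
  have "(\<lambda>x\<in>carrier M. \<psi> (?\<iota> 0 x)) \<in> mod_hom R M ?D"
    by (rule mod_hom_comp[OF power_incl_hom \<psi>(1) right_module_axioms])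
  \<comment> \<open>The index is chosen so that the retraction of the zeroth copy of
    \<open>M\<close> has no component in position \<open>n\<close>.\<close>
  then obtain n where "\<And>x. x \<in> carrier M \<Longrightarrow> (\<lambda>x\<in>carrier M. \<psi> (?\<iota> 0 x)) x (g n) = \<zero>\<^bsub>M\<^esub>"
    using finitely_generated_power_component[OF fg _ g] by blast
  then have n: "\<psi> (?\<iota> 0 x) (g n) = \<zero>\<^bsub>M\<^esub>" if "x \<in> carrier M" for x using that by simp
  \<comment> \<open>\<open>u\<close> is the entry of the matrix of \<open>\<psi>\<close> from
    position n + 1 to position \<open>n\<close>.\<close>
  define u where "u = (\<lambda>x\<in>carrier M. (\<lambda>y\<in>carrier ?D. y (g n)) ((\<lambda>x\<in>carrier M. \<psi> (?\<iota> (Suc n) x)) x))"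
  have u: "u \<in> mod_hom R M M"
    unfolding u_def
    by (rule mod_hom_comp[OF mod_hom_comp[OF power_incl_hom \<psi>(1)] power_component_hom])
      (auto simp: right_module_axioms)
  have u_apply: "u x = \<psi> (?\<iota> (Suc n) x) (g n)" if "x \<in> carrier M" for x
    using that mod_hom_closed[OF \<psi>(1) \<iota>[OF that]] by (simp add: u_def)
  have "c n x \<oplus>\<^bsub>M\<^esub> u (c (Suc n) x) = \<zero>\<^bsub>M\<^esub>" if x: "x \<in> carrier M" for x
  proof -
    have cx: "c k x \<in> carrier M" for k by (rule mod_hom_closed[OF c x])
    \<comment> \<open>The truncated orbit of \<open>x\<close> makes \<open>\<phi>\<close> telescope:
      \<open>\<phi> z\<close> is \<open>c 0 x\<close> in position 0 minus \<open>c (Suc n) x\<close>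
      in position n + 1. Applying \<open>\<psi>\<close> and reading position \<open>n\<close> gives
      the claim, since the contribution of position 0 vanishes there.\<close>
    define z where "z = seq (\<lambda>k. if k \<le> n then c k x else \<zero>\<^bsub>M\<^esub>)"
    have z: "z \<in> carrier ?D"
      unfolding z_def
    proof (rule seqI)
      show "finite {k. (if k \<le> n then c k x else \<zero>\<^bsub>M\<^esub>) \<noteq> \<zero>\<^bsub>M\<^esub>}"
        by (rule finite_subset[of _ "{..n}"]) auto
    qed (use cx in auto)
    have z_apply: "z (g k) = (if k \<le> n then c k x else \<zero>\<^bsub>M\<^esub>)" for k
      by (simp add: z_def seq_apply)
    have "\<phi> z \<oplus>\<^bsub>?D\<^esub> ?\<iota> (Suc n) (c (Suc n) x) = ?\<iota> 0 (c 0 x)"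
    proof (rule D_eqI)
      fix k
      show "(\<phi> z \<oplus>\<^bsub>?D\<^esub> ?\<iota> (Suc n) (c (Suc n) x)) (g k) = ?\<iota> 0 (c 0 x) (g k)"
      proof (cases k)
        case 0
        then show ?thesis
          using cx z by (simp add: D_add \<phi>_apply z_apply shift_def incl_apply)
      next
        case (Suc l)
        consider "l < n" | "l = n" | "l > n" by linarith
        then show ?thesis
          using cx z Suc c_Suc[OF x]
          by cases (simp_all add: D_add \<phi>_apply z_apply shift_def incl_apply a0 M.r_neg M.l_neg
              flip: c_Suc[OF x])
      qed
    qed (use mod_hom_closed[OF \<phi> z] \<iota> cx in auto)
    then have "\<psi> (\<phi> z \<oplus>\<^bsub>?D\<^esub> ?\<iota> (Suc n) (c (Suc n) x)) (g n) = \<zero>\<^bsub>M\<^esub>" using n[OF cx] by simp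
    moreover have "\<psi> (\<phi> z \<oplus>\<^bsub>?D\<^esub> ?\<iota> (Suc n) (c (Suc n) x)) =
        z \<oplus>\<^bsub>?D\<^esub> \<psi> (?\<iota> (Suc n) (c (Suc n) x))"
      using mod_hom_add[OF \<psi>(1) mod_hom_closed[OF \<phi> z] \<iota>[OF cx]] \<psi>(2)[OF z] by simp
    ultimately show ?thesis using z_apply[of n] u_apply[OF cx] by (simp add: D_add)
  qed
  then show ?thesis using u by blast
qed

lemma endo_ring_minimal_principal:
  assumes "infinite (UNIV :: 'i set)" "sigma_d_rickart TYPE('i) R M" "finitely_generated R M"
  defines "S \<equiv> endo_ring R M"
  assumes C: "C \<subseteq> carrier S" "C \<noteq> {}"
  shows "\<exists>a\<in>C. \<forall>s\<in>carrier S. s \<otimes>\<^bsub>S\<^esub> a \<in> C \<longrightarrow> (\<exists>t\<in>carrier S. a = t \<otimes>\<^bsub>S\<^esub> (s \<otimes>\<^bsub>S\<^esub> a))"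
proof (rule ccontr)
  interpret S: ring S unfolding S_def by (rule ring_endo_ring)
  assume neg: "\<not> ?thesis"
  have "\<forall>a\<in>C. \<exists>s. s \<in> carrier S \<and> s \<otimes>\<^bsub>S\<^esub> a \<in> C \<and> \<not> (\<exists>t\<in>carrier S. a = t \<otimes>\<^bsub>S\<^esub> (s \<otimes>\<^bsub>S\<^esub> a))"
    using neg by blast
  then obtain \<sigma> where \<sigma>: "\<forall>a\<in>C. \<sigma> a \<in> carrier S \<and> \<sigma> a \<otimes>\<^bsub>S\<^esub> a \<in> C \<and>
      \<not> (\<exists>t\<in>carrier S. a = t \<otimes>\<^bsub>S\<^esub> (\<sigma> a \<otimes>\<^bsub>S\<^esub> a))"
    by (rule bchoice[THEN exE])
  obtain c\<^sub>0 where c\<^sub>0: "c\<^sub>0 \<in> C" using C(2) by blast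
  \<comment> \<open>Iterating the choice gives a chain in which no \<open>c n\<close> is a left
    multiple of its successor, so a single stationary index is already a contradiction.\<close>
  define c where "c n = ((\<lambda>a. \<sigma> a \<otimes>\<^bsub>S\<^esub> a) ^^ n) c\<^sub>0" for n
  have c_Suc: "c (Suc n) = \<sigma> (c n) \<otimes>\<^bsub>S\<^esub> c n" for n by (simp add: c_def)
  have cC: "c n \<in> C" for n
  proof (induction n)
    case 0
    then show ?case using c\<^sub>0 by (simp add: c_def)
  next
    case (Suc n)
    then show ?case using \<sigma> c_Suc by simp
  qed
  have hom_S: "f \<in> carrier S \<longleftrightarrow> f \<in> mod_hom R M M" for f by (simp add: S_def endo_ring_carrier)
  have cS: "c n \<in> carrier S" for n using cC C(1) by blast
  have \<sigma>S: "\<sigma> (c n) \<in> carrier S" for n using cC \<sigma> by blast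
  obtain g :: "nat \<Rightarrow> 'i" where g: "inj g"
    using infinite_countable_subset[OF assms(1)] by blast
  have rickart: "d_rickart R (direct_power M (range g))" using assms(2) by (simp add: sigma_d_rickart_def)
  obtain n u where u: "u \<in> mod_hom R M M"
    "\<forall>x\<in>carrier M. c n x \<oplus>\<^bsub>M\<^esub> u (c (Suc n) x) = \<zero>\<^bsub>M\<^esub>"
  proof -
    have "\<exists>n. \<exists>u\<in>mod_hom R M M. \<forall>x\<in>carrier M. c n x \<oplus>\<^bsub>M\<^esub> u (c (Suc n) x) = \<zero>\<^bsub>M\<^esub>"
    proof (rule principal_chain_stable[OF assms(3) g rickart])
      show "\<sigma> (c n) \<in> mod_hom R M M" "c n \<in> mod_hom R M M" for n using \<sigma>S cS hom_S by auto
      show "c (Suc n) x = \<sigma> (c n) (c n x)" if "x \<in> carrier M" for n x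
        unfolding c_Suc using that by (simp add: S_def endo_ring_apply)
    qed
    then show thesis using that by blast
  qed
  have uS: "u \<in> carrier S" using u(1) hom_S by blast
  have "c n \<oplus>\<^bsub>S\<^esub> u \<otimes>\<^bsub>S\<^esub> c (Suc n) = \<zero>\<^bsub>S\<^esub>"
  proof (rule endo_ring_eqI)
    show "c n \<oplus>\<^bsub>S\<^esub> u \<otimes>\<^bsub>S\<^esub> c (Suc n) \<in> carrier (endo_ring R M)" "\<zero>\<^bsub>S\<^esub> \<in> carrier (endo_ring R M)"
      using cS uS unfolding S_def[symmetric] by auto
    show "(c n \<oplus>\<^bsub>S\<^esub> u \<otimes>\<^bsub>S\<^esub> c (Suc n)) x = \<zero>\<^bsub>S\<^esub> x" if "x \<in> carrier M" for x
      using u(2) that by (simp add: S_def endo_ring_apply)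
  qed
  then have "c n = (\<ominus>\<^bsub>S\<^esub> u) \<otimes>\<^bsub>S\<^esub> c (Suc n)"
    using cS uS S.minus_equality[of "c n" "u \<otimes>\<^bsub>S\<^esub> c (Suc n)"] by (simp add: S.l_minus)
  moreover have "\<not> (\<exists>t\<in>carrier S. c n = t \<otimes>\<^bsub>S\<^esub> (\<sigma> (c n) \<otimes>\<^bsub>S\<^esub> c n))" using \<sigma> cC by blast
  ultimately show False using c_Suc uS by (metis S.a_inv_closed)
qed

end

theorem proposition5p3:
  fixes A :: "('a, 'c) ring_scheme"
    and X :: "('a, 'x) module"
  assumes "ring A"
    and "right_module A X"
    and "finitely_generated A X"
    and "infinite (UNIV :: 'i set)"
    and "sigma_d_rickart TYPE('i) A X"
  shows "left_hereditary TYPE('m) TYPE('n) (endo_ring A X)"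
proof -
  interpret X: right_module A X by fact
  \<comment> \<open>The infinite type \<open>'i\<close> serves twice: it contains finite index sets
    of every size, for \<open>split\<close>, and an injective image of the natural numbers, for
    \<open>minimal_principal\<close>.\<close>
  interpret S: split_minimal_ring "endo_ring A X"
    by (intro split_minimal_ring.intro split_minimal_ring_axioms.intro X.ring_endo_ring
        X.endo_ring_minimal_principal[OF assms(4,5,3)] X.endo_ring_split[OF assms(4,5)])
  show ?thesis by (rule S.left_hereditary)
qed

end
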